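(* Let $\mathcal{E}$ be an exact category and suppose that $\mathcal{P}$ is a projective cover of $\mathcal{E}$. Then $\mathcal{P}_{\mathrm{ex}}\simeq\mathcal{E}$.
   Context: Conventions. $\mathsf{Pos}$ is the cartesian closed category of posets and monotone maps. "Category" means $\mathsf{Pos}$-enriched category: each hom-set is a poset and composition is monotone in both variables. "Functor" means $\mathsf{Pos}$-enriched (locally monotone) functor, and $\simeq$ denotes equivalence of $\mathsf{Pos}$-enriched categories. Limits. For $D\colon\mathcal{D}\to\mathcal{C}$ and a weight $W\colon\mathcal{D}\to\mathsf{Pos}$, the limit $\{W,D\}$ is defined by an isomorphism of posets $\mathcal{C}(X,\{W,D\})\cong[\mathcal{D},\mathsf{Pos}](W,\mathcal{C}(X,D-))$ natural in $X$. The weight is finite if $\mathcal{D}$ has finitely many isomorphism classes of objects and all posets $\mathcal{D}(d,d')$ and $Wd$ are finite. "Finite limits" are limits with finite weights. A weak $W$-weighted limit is an object $\{W,D\}_w$ with a natural transformation $W\to\mathcal{C}(\{W,D\}_w,D-)$ such that for all $X$ the induced map $\mathcal{C}(X,\{W,D\}_w)\to[\mathcal{D},\mathsf{Pos}](W,\mathcal{C}(X,D-))$ is surjective. $\mathcal{C}$ is weakly lex if it has all weak limits with finite weights. Exactness. A morphism $m$ is an order-monomorphism if $mu\leq mv$ implies $u\leq v$. A morphism $e\colon A\to B$ is an $\mathsf{so}$-morphism if for every order-monomorphism $m\colon X\to Y$ the commutative square with vertices $\mathcal{C}(B,X),\mathcal{C}(A,X),\mathcal{C}(B,Y),\mathcal{C}(A,Y)$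 (maps given by precomposition with $e$ and postcomposition with $m$) is a pullback in $\mathsf{Pos}$. A category is regular if it has all finite limits, every morphism factors as an $\mathsf{so}$-morphism followed by an order-monomorphism, and $\mathsf{so}$-morphisms are stable under pullback. A congruence on $X$ is a relation (order-monic $E\rightarrowtail X\times X$) that is reflexive, transitive and an order-ideal (if $(x,y)\colon A\to X\times X$ factors through $E$, $x'\leq x$, $y\leq y'$, then $(x',y')$ factors through $E$). It is effective if it is the kernel congruence (comma object $f/f$, the universal pair $c_0,c_1$ with $fc_0\leq fc_1$) of some morphism $f$. A category is exact if it is regular and every congruence is effective. Projective covers. An object $P$ of a regular category $\mathcal{E}$ is projective if $\mathcal{E}(P,-)\colon\mathcal{E}\to\mathsf{Pos}$ preserves $\mathsf{so}$-morphisms (those of $\mathsf{Pos}$ are the surjective monotone maps). A full subcategory $\mathcal{P}$ of $\mathcal{E}$ is a projective cover if every $P\in\mathcal{P}$ is projective in $\mathcal{E}$ and for every $C\in\mathcal{E}$ there are $P\in\mathcal{P}$ and an $\mathsf{so}$-morphism $P\twoheadrightarrow C$. A projective cover of a category with finite limits is weakly lex, so $\mathcal{P}_{\mathrm{ex}}$ is defined. The category $\mathcal{C}_{\mathrm{ex}}$ for $\mathcal{C}$ weakly lex. A pseudocongruence in $\mathcal{C}$ is a parallel pair $r_0,r_1\colon R\to X$ such that: (1) for every $a_0\leq a_1\colon A\to X$ there is $u\colon A\to R$ with $r_0u=a_0$, $r_1u=a_1$; (2) for a weak pullback $d_0,d_1\colon R*R\to R$ with $r_1d_0=r_0d_1$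 there is $\tau\colon R*R\to R$ with $r_0\tau=r_0d_0$, $r_1\tau=r_1d_1$. Objects of $\mathcal{C}_{\mathrm{ex}}$ are the pseudocongruences, written $(X,R)$. Given $(X,R)$ and $(Y,S)$, consider $f\colon X\to Y$ in $\mathcal{C}$ for which there is $\bar f\colon R\to S$ with $s_0\bar f=fr_0$, $s_1\bar f=fr_1$; put $f\preccurlyeq g$ iff there is $\Sigma\colon X\to S$ with $s_0\Sigma=f$, $s_1\Sigma=g$ (a preorder). Morphisms $[f]\colon(X,R)\to(Y,S)$ are the classes of such $f$ under the induced equivalence relation, ordered by $[f]\leq[g]$ iff $f\preccurlyeq g$, with composition induced from $\mathcal{C}$. *)

theory Defs
  imports "HOL-Library.FuncSet"
begin

section \<open>Posets on a carrier set\<close>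

definition poset_on :: "'a set \<Rightarrow> ('a \<Rightarrow> 'a \<Rightarrow> bool) \<Rightarrow> bool" where
  "poset_on A le \<longleftrightarrow> reflp_on A le \<and> antisymp_on A le \<and> transp_on A le"

definition poset_iso ::
  "'a set \<Rightarrow> ('a \<Rightarrow> 'a \<Rightarrow> bool) \<Rightarrow> 'b set \<Rightarrow> ('b \<Rightarrow> 'b \<Rightarrow> bool) \<Rightarrow> ('a \<Rightarrow> 'b) \<Rightarrow> bool" where
  "poset_iso A leA B leB h \<longleftrightarrow>
     bij_betw h A B \<and> (\<forall>x\<in>A. \<forall>y\<in>A. leA x y \<longleftrightarrow> leB (h x) (h y))"


section \<open>Pos-enriched categories, functors and equivalences\<close>

text \<open>Arrows carry their domain and codomain, so hom-sets are disjoint. The operations are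
  total functions; only their values on (composable, resp. parallel) arrows matter.\<close>

record ('o, 'm) pos_cat =
  Obj :: "'o set"
  Arr :: "'m set"
  Dom :: "'m \<Rightarrow> 'o"
  Cod :: "'m \<Rightarrow> 'o"
  Ident :: "'o \<Rightarrow> 'm"
  Comp :: "'m \<Rightarrow> 'm \<Rightarrow> 'm"  (infixl "\<cdot>\<index>" 70)
  Le :: "'m \<Rightarrow> 'm \<Rightarrow> bool"  (infix "\<preceq>\<index>" 50)

definition Hom :: "('o, 'm) pos_cat \<Rightarrow> 'o \<Rightarrow> 'o \<Rightarrow> 'm set" where
  "Hom C x y = {f \<in> Arr C. Dom C f = x \<and> Cod C f = y}"

locale pos_category =
  fixes C :: "('o, 'm) pos_cat" (structure)
  assumes Dom_in_Obj: "f \<in> Arr C \<Longrightarrow> Dom C f \<in> Obj C"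
    and Cod_in_Obj: "f \<in> Arr C \<Longrightarrow> Cod C f \<in> Obj C"
    and Ident_in_Hom: "x \<in> Obj C \<Longrightarrow> Ident C x \<in> Hom C x x"
    and Comp_in_Hom: "f \<in> Hom C x y \<Longrightarrow> g \<in> Hom C y z \<Longrightarrow> g \<cdot> f \<in> Hom C x z"
    and Comp_Ident: "f \<in> Hom C x y \<Longrightarrow> f \<cdot> Ident C x = f"
    and Ident_Comp: "f \<in> Hom C x y \<Longrightarrow> Ident C y \<cdot> f = f"
    and Comp_assoc: "f \<in> Hom C w x \<Longrightarrow> g \<in> Hom C x y \<Longrightarrow> h \<in> Hom C y z \<Longrightarrow>
                       (h \<cdot> g) \<cdot> f = h \<cdot> (g \<cdot> f)"
    and Hom_poset: "x \<in> Obj C \<Longrightarrow> y \<in> Obj C \<Longrightarrow> poset_on (Hom C x y) (Le C)"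
    and Comp_mono: "f \<in> Hom C x y \<Longrightarrow> f' \<in> Hom C x y \<Longrightarrow> g \<in> Hom C y z \<Longrightarrow> g' \<in> Hom C y z \<Longrightarrow>
                      f \<preceq> f' \<Longrightarrow> g \<preceq> g' \<Longrightarrow> g \<cdot> f \<preceq> g' \<cdot> f'"

definition iso_arrow :: "('o, 'm) pos_cat \<Rightarrow> 'm \<Rightarrow> bool" where
  "iso_arrow C f \<longleftrightarrow> f \<in> Arr C \<and>
     (\<exists>g\<in>Hom C (Cod C f) (Dom C f).
        g \<cdot>\<^bsub>C\<^esub> f = Ident C (Dom C f) \<and> f \<cdot>\<^bsub>C\<^esub> g = Ident C (Cod C f))"

definition isomorphic :: "('o, 'm) pos_cat \<Rightarrow> 'o \<Rightarrow> 'o \<Rightarrow> bool" where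
  "isomorphic C x y \<longleftrightarrow> (\<exists>f\<in>Hom C x y. iso_arrow C f)"

definition full_subcategory :: "('o, 'm) pos_cat \<Rightarrow> 'o set \<Rightarrow> ('o, 'm) pos_cat" where
  "full_subcategory C P = C\<lparr>Obj := P, Arr := {f \<in> Arr C. Dom C f \<in> P \<and> Cod C f \<in> P}\<rparr>"

record ('o, 'm, 'p, 'n) pos_fun =
  fobj :: "'o \<Rightarrow> 'p"
  farr :: "'m \<Rightarrow> 'n"

definition pos_functor ::
  "('o, 'm) pos_cat \<Rightarrow> ('p, 'n) pos_cat \<Rightarrow> ('o, 'm, 'p, 'n) pos_fun \<Rightarrow> bool" where
  "pos_functor A B F \<longleftrightarrow> pos_category A \<and> pos_category B \<and>
     (\<forall>x\<in>Obj A. fobj F x \<in> Obj B) \<and>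
     (\<forall>x\<in>Obj A. \<forall>y\<in>Obj A. \<forall>f\<in>Hom A x y. farr F f \<in> Hom B (fobj F x) (fobj F y)) \<and>
     (\<forall>x\<in>Obj A. farr F (Ident A x) = Ident B (fobj F x)) \<and>
     (\<forall>x\<in>Obj A. \<forall>y\<in>Obj A. \<forall>z\<in>Obj A. \<forall>f\<in>Hom A x y. \<forall>g\<in>Hom A y z.
        farr F (g \<cdot>\<^bsub>A\<^esub> f) = farr F g \<cdot>\<^bsub>B\<^esub> farr F f) \<and>
     (\<forall>x\<in>Obj A. \<forall>y\<in>Obj A. monotone_on (Hom A x y) (Le A) (Le B) (farr F))"

definition id_fun :: "('o, 'm, 'o, 'm) pos_fun" where
  "id_fun = \<lparr>fobj = (\<lambda>x. x), farr = (\<lambda>f. f)\<rparr>"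

definition comp_fun ::
  "('p, 'n, 'q, 'k) pos_fun \<Rightarrow> ('o, 'm, 'p, 'n) pos_fun \<Rightarrow> ('o, 'm, 'q, 'k) pos_fun" where
  "comp_fun G F = \<lparr>fobj = fobj G \<circ> fobj F, farr = farr G \<circ> farr F\<rparr>"

text \<open>For enrichment in posets, an enriched natural transformation is the same as an ordinary one.\<close>

definition natural_iso ::
  "('o, 'm) pos_cat \<Rightarrow> ('p, 'n) pos_cat \<Rightarrow> ('o, 'm, 'p, 'n) pos_fun \<Rightarrow> ('o, 'm, 'p, 'n) pos_fun \<Rightarrow>
   ('o \<Rightarrow> 'n) \<Rightarrow> bool" where
  "natural_iso A B F G \<tau> \<longleftrightarrow>
     (\<forall>x\<in>Obj A. \<tau> x \<in> Hom B (fobj F x) (fobj G x) \<and> iso_arrow B (\<tau> x)) \<and>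
     (\<forall>x\<in>Obj A. \<forall>y\<in>Obj A. \<forall>f\<in>Hom A x y. farr G f \<cdot>\<^bsub>B\<^esub> \<tau> x = \<tau> y \<cdot>\<^bsub>B\<^esub> farr F f)"

definition equivalent_categories :: "('o, 'm) pos_cat \<Rightarrow> ('p, 'n) pos_cat \<Rightarrow> bool" where
  "equivalent_categories A B \<longleftrightarrow>
     (\<exists>F G \<eta> \<epsilon>. pos_functor A B F \<and> pos_functor B A G \<and>
        natural_iso A A id_fun (comp_fun G F) \<eta> \<and>
        natural_iso B B (comp_fun F G) id_fun \<epsilon>)"


section \<open>Weighted limits\<close>

text \<open>A weight \<open>J \<rightarrow> Pos\<close>, with the posets given by carriers and orders on a fixed type.\<close>

record ('i, 'j, 'w) weight =
  wcar :: "'i \<Rightarrow> 'w set"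
  wle :: "'i \<Rightarrow> 'w \<Rightarrow> 'w \<Rightarrow> bool"
  wmap :: "'j \<Rightarrow> 'w \<Rightarrow> 'w"

definition is_weight :: "('i, 'j) pos_cat \<Rightarrow> ('i, 'j, 'w) weight \<Rightarrow> bool" where
  "is_weight J W \<longleftrightarrow> pos_category J \<and>
     (\<forall>d\<in>Obj J. poset_on (wcar W d) (wle W d)) \<and>
     (\<forall>d\<in>Obj J. \<forall>d'\<in>Obj J. \<forall>f\<in>Hom J d d'.
        wmap W f \<in> wcar W d \<rightarrow> wcar W d' \<and>
        monotone_on (wcar W d) (wle W d) (wle W d') (wmap W f)) \<and>
     (\<forall>d\<in>Obj J. \<forall>w\<in>wcar W d. wmap W (Ident J d) w = w) \<and>
     (\<forall>c\<in>Obj J. \<forall>d\<in>Obj J. \<forall>e\<in>Obj J. \<forall>f\<in>Hom J c d. \<forall>g\<in>Hom J d e. \<forall>w\<in>wcar W c.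
        wmap W (g \<cdot>\<^bsub>J\<^esub> f) w = wmap W g (wmap W f w)) \<and>
     (\<forall>d\<in>Obj J. \<forall>d'\<in>Obj J. \<forall>f\<in>Hom J d d'. \<forall>g\<in>Hom J d d'. f \<preceq>\<^bsub>J\<^esub> g \<longrightarrow>
        (\<forall>w\<in>wcar W d. wle W d' (wmap W f w) (wmap W g w)))"

definition finite_weight :: "('i, 'j) pos_cat \<Rightarrow> ('i, 'j, 'w) weight \<Rightarrow> bool" where
  "finite_weight J W \<longleftrightarrow> is_weight J W \<and>
     finite ((\<lambda>d. {d' \<in> Obj J. isomorphic J d d'}) ` Obj J) \<and>
     (\<forall>d\<in>Obj J. \<forall>d'\<in>Obj J. finite (Hom J d d')) \<and>
     (\<forall>d\<in>Obj J. finite (wcar W d))"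

text \<open>The poset \<open>[J, Pos](W, C(X, D-))\<close> of natural transformations.  Functions are taken
  extensional, so that equality of functions is equality of natural transformations.\<close>

definition wcones ::
  "('o, 'm) pos_cat \<Rightarrow> ('i, 'j) pos_cat \<Rightarrow> ('i, 'j, 'o, 'm) pos_fun \<Rightarrow> ('i, 'j, 'w) weight \<Rightarrow>
   'o \<Rightarrow> ('i \<Rightarrow> 'w \<Rightarrow> 'm) set" where
  "wcones C J D W X =
     {\<phi> \<in> (\<Pi>\<^sub>E d\<in>Obj J. \<Pi>\<^sub>E w\<in>wcar W d. Hom C X (fobj D d)).
        (\<forall>d\<in>Obj J. monotone_on (wcar W d) (wle W d) (Le C) (\<phi> d)) \<and>
        (\<forall>d\<in>Obj J. \<forall>d'\<in>Obj J. \<forall>f\<in>Hom J d d'. \<forall>w\<in>wcar W d.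
           \<phi> d' (wmap W f w) = farr D f \<cdot>\<^bsub>C\<^esub> \<phi> d w)}"

definition wcone_le ::
  "('o, 'm) pos_cat \<Rightarrow> ('i, 'j) pos_cat \<Rightarrow> ('i, 'j, 'w) weight \<Rightarrow>
   ('i \<Rightarrow> 'w \<Rightarrow> 'm) \<Rightarrow> ('i \<Rightarrow> 'w \<Rightarrow> 'm) \<Rightarrow> bool" where
  "wcone_le C J W \<phi> \<psi> \<longleftrightarrow> (\<forall>d\<in>Obj J. \<forall>w\<in>wcar W d. \<phi> d w \<preceq>\<^bsub>C\<^esub> \<psi> d w)"

definition wcone_comp ::
  "('o, 'm) pos_cat \<Rightarrow> ('i, 'j) pos_cat \<Rightarrow> ('i, 'j, 'w) weight \<Rightarrow>
   ('i \<Rightarrow> 'w \<Rightarrow> 'm) \<Rightarrow> 'm \<Rightarrow> ('i \<Rightarrow> 'w \<Rightarrow> 'm)" where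
  "wcone_comp C J W \<phi> f = (\<lambda>d\<in>Obj J. \<lambda>w\<in>wcar W d. \<phi> d w \<cdot>\<^bsub>C\<^esub> f)"

definition is_weighted_limit ::
  "('o, 'm) pos_cat \<Rightarrow> ('i, 'j) pos_cat \<Rightarrow> ('i, 'j, 'o, 'm) pos_fun \<Rightarrow> ('i, 'j, 'w) weight \<Rightarrow>
   'o \<Rightarrow> bool" where
  "is_weighted_limit C J D W L \<longleftrightarrow> L \<in> Obj C \<and>
     (\<exists>\<Phi>. (\<forall>X\<in>Obj C. poset_iso (Hom C X L) (Le C) (wcones C J D W X) (wcone_le C J W) (\<Phi> X)) \<and>
          (\<forall>X\<in>Obj C. \<forall>Y\<in>Obj C. \<forall>f\<in>Hom C Y X. \<forall>h\<in>Hom C X L.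
             \<Phi> Y (h \<cdot>\<^bsub>C\<^esub> f) = wcone_comp C J W (\<Phi> X h) f))"

definition is_weak_weighted_limit ::
  "('o, 'm) pos_cat \<Rightarrow> ('i, 'j) pos_cat \<Rightarrow> ('i, 'j, 'o, 'm) pos_fun \<Rightarrow> ('i, 'j, 'w) weight \<Rightarrow>
   'o \<Rightarrow> bool" where
  "is_weak_weighted_limit C J D W L \<longleftrightarrow> L \<in> Obj C \<and>
     (\<exists>\<kappa>\<in>wcones C J D W L. \<forall>X\<in>Obj C. wcone_comp C J W \<kappa> ` Hom C X L = wcones C J D W X)"

text \<open>A finite weight may be replaced by one on the skeleton of \<open>J\<close>, which is a finite category;
  so it is no restriction to let \<open>J\<close> and the values of \<open>W\<close> live on the type of natural numbers.\<close>

definition has_finite_limits :: "('o, 'm) pos_cat \<Rightarrow> bool" where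
  "has_finite_limits C \<longleftrightarrow>
     (\<forall>(J :: (nat, nat) pos_cat) (W :: (nat, nat, nat) weight) D.
        finite_weight J W \<and> pos_functor J C D \<longrightarrow> (\<exists>L. is_weighted_limit C J D W L))"

definition weakly_lex :: "('o, 'm) pos_cat \<Rightarrow> bool" where
  "weakly_lex C \<longleftrightarrow> pos_category C \<and>
     (\<forall>(J :: (nat, nat) pos_cat) (W :: (nat, nat, nat) weight) D.
        finite_weight J W \<and> pos_functor J C D \<longrightarrow> (\<exists>L. is_weak_weighted_limit C J D W L))"


section \<open>Particular limits\<close>

text \<open>\<open>rel_prod\<close> is the componentwise order on pairs: being limits in the enriched sense,
  these are given by isomorphisms of posets, not merely bijections.\<close>

definition is_product :: "('o, 'm) pos_cat \<Rightarrow> 'o \<Rightarrow> 'o \<Rightarrow> 'o \<Rightarrow> 'm \<Rightarrow> 'm \<Rightarrow> bool" where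
  "is_product C X Y Q p q \<longleftrightarrow>
     X \<in> Obj C \<and> Y \<in> Obj C \<and> Q \<in> Obj C \<and> p \<in> Hom C Q X \<and> q \<in> Hom C Q Y \<and>
     (\<forall>A\<in>Obj C. poset_iso (Hom C A Q) (Le C)
        (Hom C A X \<times> Hom C A Y) (rel_prod (Le C) (Le C)) (\<lambda>h. (p \<cdot>\<^bsub>C\<^esub> h, q \<cdot>\<^bsub>C\<^esub> h)))"

definition cospan :: "('o, 'm) pos_cat \<Rightarrow> 'm \<Rightarrow> 'm \<Rightarrow> bool" where
  "cospan C f g \<longleftrightarrow> f \<in> Arr C \<and> g \<in> Arr C \<and> Cod C f = Cod C g"

definition span_over :: "('o, 'm) pos_cat \<Rightarrow> 'm \<Rightarrow> 'm \<Rightarrow> 'm \<Rightarrow> 'm \<Rightarrow> bool" where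
  "span_over C f g p q \<longleftrightarrow>
     p \<in> Arr C \<and> q \<in> Arr C \<and> Dom C p = Dom C q \<and> Cod C p = Dom C f \<and> Cod C q = Dom C g"

text \<open>The pullback square is \<open>f \<cdot> p = g \<cdot> q\<close>.\<close>

definition is_pullback :: "('o, 'm) pos_cat \<Rightarrow> 'm \<Rightarrow> 'm \<Rightarrow> 'm \<Rightarrow> 'm \<Rightarrow> bool" where
  "is_pullback C f g p q \<longleftrightarrow> cospan C f g \<and> span_over C f g p q \<and> f \<cdot>\<^bsub>C\<^esub> p = g \<cdot>\<^bsub>C\<^esub> q \<and>
     (\<forall>A\<in>Obj C. poset_iso (Hom C A (Dom C p)) (Le C)
        {(u, v) \<in> Hom C A (Dom C f) \<times> Hom C A (Dom C g). f \<cdot>\<^bsub>C\<^esub> u = g \<cdot>\<^bsub>C\<^esub> v}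
        (rel_prod (Le C) (Le C)) (\<lambda>h. (p \<cdot>\<^bsub>C\<^esub> h, q \<cdot>\<^bsub>C\<^esub> h)))"

definition is_weak_pullback :: "('o, 'm) pos_cat \<Rightarrow> 'm \<Rightarrow> 'm \<Rightarrow> 'm \<Rightarrow> 'm \<Rightarrow> bool" where
  "is_weak_pullback C f g p q \<longleftrightarrow> cospan C f g \<and> span_over C f g p q \<and> f \<cdot>\<^bsub>C\<^esub> p = g \<cdot>\<^bsub>C\<^esub> q \<and>
     (\<forall>A\<in>Obj C. (\<lambda>h. (p \<cdot>\<^bsub>C\<^esub> h, q \<cdot>\<^bsub>C\<^esub> h)) ` Hom C A (Dom C p) =
        {(u, v) \<in> Hom C A (Dom C f) \<times> Hom C A (Dom C g). f \<cdot>\<^bsub>C\<^esub> u = g \<cdot>\<^bsub>C\<^esub> v})"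

text \<open>The comma object \<open>f/g\<close>, with universal inequality \<open>f \<cdot> p \<preceq> g \<cdot> q\<close>.\<close>

definition is_comma :: "('o, 'm) pos_cat \<Rightarrow> 'm \<Rightarrow> 'm \<Rightarrow> 'm \<Rightarrow> 'm \<Rightarrow> bool" where
  "is_comma C f g p q \<longleftrightarrow> cospan C f g \<and> span_over C f g p q \<and> f \<cdot>\<^bsub>C\<^esub> p \<preceq>\<^bsub>C\<^esub> g \<cdot>\<^bsub>C\<^esub> q \<and>
     (\<forall>A\<in>Obj C. poset_iso (Hom C A (Dom C p)) (Le C)
        {(u, v) \<in> Hom C A (Dom C f) \<times> Hom C A (Dom C g). f \<cdot>\<^bsub>C\<^esub> u \<preceq>\<^bsub>C\<^esub> g \<cdot>\<^bsub>C\<^esub> v}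
        (rel_prod (Le C) (Le C)) (\<lambda>h. (p \<cdot>\<^bsub>C\<^esub> h, q \<cdot>\<^bsub>C\<^esub> h)))"


section \<open>Regular and exact categories\<close>

definition order_mono :: "('o, 'm) pos_cat \<Rightarrow> 'm \<Rightarrow> bool" where
  "order_mono C m \<longleftrightarrow> m \<in> Arr C \<and>
     (\<forall>A\<in>Obj C. \<forall>u\<in>Hom C A (Dom C m). \<forall>v\<in>Hom C A (Dom C m).
        m \<cdot>\<^bsub>C\<^esub> u \<preceq>\<^bsub>C\<^esub> m \<cdot>\<^bsub>C\<^esub> v \<longrightarrow> u \<preceq>\<^bsub>C\<^esub> v)"

text \<open>For \<open>e : A \<rightarrow> B\<close> and \<open>m : X \<rightarrow> Y\<close>, the square of hom-posets is a pullback iff the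
  comparison map from \<open>C(B, X)\<close> to the pullback of posets is an isomorphism.\<close>

definition so_morphism :: "('o, 'm) pos_cat \<Rightarrow> 'm \<Rightarrow> bool" where
  "so_morphism C e \<longleftrightarrow> e \<in> Arr C \<and>
     (\<forall>m. order_mono C m \<longrightarrow>
        poset_iso (Hom C (Cod C e) (Dom C m)) (Le C)
          {(u, v) \<in> Hom C (Dom C e) (Dom C m) \<times> Hom C (Cod C e) (Cod C m). m \<cdot>\<^bsub>C\<^esub> u = v \<cdot>\<^bsub>C\<^esub> e}
          (rel_prod (Le C) (Le C)) (\<lambda>d. (d \<cdot>\<^bsub>C\<^esub> e, m \<cdot>\<^bsub>C\<^esub> d)))"

definition regular_category :: "('o, 'm) pos_cat \<Rightarrow> bool" where
  "regular_category C \<longleftrightarrow> pos_category C \<and> has_finite_limits C \<and>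
     (\<forall>f\<in>Arr C. \<exists>e m. so_morphism C e \<and> order_mono C m \<and>
        Dom C e = Dom C f \<and> Cod C e = Dom C m \<and> Cod C m = Cod C f \<and> f = m \<cdot>\<^bsub>C\<^esub> e) \<and>
     (\<forall>f g p q. is_pullback C f g p q \<and> so_morphism C f \<longrightarrow> so_morphism C q)"

text \<open>An order-monic \<open>R \<rightarrowtail> X \<times> X\<close> is represented by its two components \<open>e\<^sub>0, e\<^sub>1 : R \<rightarrow> X\<close>;
  a pair \<open>(x, y) : A \<rightarrow> X \<times> X\<close> factors through it iff \<open>x = e\<^sub>0 \<cdot> u\<close> and \<open>y = e\<^sub>1 \<cdot> u\<close> for some \<open>u\<close>.\<close>

definition relation_on :: "('o, 'm) pos_cat \<Rightarrow> 'o \<Rightarrow> 'm \<Rightarrow> 'm \<Rightarrow> bool" where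
  "relation_on C X e0 e1 \<longleftrightarrow>
     (\<exists>Q p q m. is_product C X X Q p q \<and> order_mono C m \<and> Cod C m = Q \<and>
        e0 = p \<cdot>\<^bsub>C\<^esub> m \<and> e1 = q \<cdot>\<^bsub>C\<^esub> m)"

definition factors_through :: "('o, 'm) pos_cat \<Rightarrow> 'm \<Rightarrow> 'm \<Rightarrow> 'm \<Rightarrow> 'm \<Rightarrow> bool" where
  "factors_through C e0 e1 x y \<longleftrightarrow>
     (\<exists>u\<in>Hom C (Dom C x) (Dom C e0). e0 \<cdot>\<^bsub>C\<^esub> u = x \<and> e1 \<cdot>\<^bsub>C\<^esub> u = y)"

definition congruence_on :: "('o, 'm) pos_cat \<Rightarrow> 'o \<Rightarrow> 'm \<Rightarrow> 'm \<Rightarrow> bool" where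
  "congruence_on C X e0 e1 \<longleftrightarrow> relation_on C X e0 e1 \<and>
     (\<forall>A\<in>Obj C. \<forall>x\<in>Hom C A X. factors_through C e0 e1 x x) \<and>
     (\<forall>A\<in>Obj C. \<forall>x\<in>Hom C A X. \<forall>y\<in>Hom C A X. \<forall>z\<in>Hom C A X.
        factors_through C e0 e1 x y \<and> factors_through C e0 e1 y z \<longrightarrow>
        factors_through C e0 e1 x z) \<and>
     (\<forall>A\<in>Obj C. \<forall>x\<in>Hom C A X. \<forall>y\<in>Hom C A X. \<forall>x'\<in>Hom C A X. \<forall>y'\<in>Hom C A X.
        factors_through C e0 e1 x y \<and> x' \<preceq>\<^bsub>C\<^esub> x \<and> y \<preceq>\<^bsub>C\<^esub> y' \<longrightarrow>
        factors_through C e0 e1 x' y')"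

definition effective :: "('o, 'm) pos_cat \<Rightarrow> 'm \<Rightarrow> 'm \<Rightarrow> bool" where
  "effective C e0 e1 \<longleftrightarrow> (\<exists>f. is_comma C f f e0 e1)"

definition exact_category :: "('o, 'm) pos_cat \<Rightarrow> bool" where
  "exact_category C \<longleftrightarrow> regular_category C \<and>
     (\<forall>X e0 e1. congruence_on C X e0 e1 \<longrightarrow> effective C e0 e1)"


section \<open>Projective covers\<close>

text \<open>\<open>C(P, -)\<close> takes so-morphisms to so-morphisms of Pos, which are the surjective monotone maps.\<close>

definition projective :: "('o, 'm) pos_cat \<Rightarrow> 'o \<Rightarrow> bool" where
  "projective C P \<longleftrightarrow> P \<in> Obj C \<and>
     (\<forall>e. so_morphism C e \<longrightarrow> (\<lambda>h. e \<cdot>\<^bsub>C\<^esub> h) ` Hom C P (Dom C e) = Hom C P (Cod C e))"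

definition projective_cover :: "('o, 'm) pos_cat \<Rightarrow> 'o set \<Rightarrow> bool" where
  "projective_cover E \<P> \<longleftrightarrow>
     (\<forall>P\<in>\<P>. projective E P) \<and>
     (\<forall>X\<in>Obj E. \<exists>P\<in>\<P>. \<exists>e\<in>Hom E P X. so_morphism E e)"


section \<open>The exact completion of a weakly lex category\<close>

text \<open>A pseudocongruence \<open>(X, R)\<close> is the pair \<open>(r\<^sub>0, r\<^sub>1)\<close> of its structure maps \<open>R \<rightarrow> X\<close>.
  If \<open>C\<close> is weakly lex, it does not matter which weak pullback is taken.\<close>

definition pseudocongruence :: "('o, 'm) pos_cat \<Rightarrow> 'm \<times> 'm \<Rightarrow> bool" where
  "pseudocongruence C = (\<lambda>(r0, r1).
     r0 \<in> Arr C \<and> r1 \<in> Arr C \<and> Dom C r0 = Dom C r1 \<and> Cod C r0 = Cod C r1 \<and>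
     (\<forall>A\<in>Obj C. \<forall>a0\<in>Hom C A (Cod C r0). \<forall>a1\<in>Hom C A (Cod C r0). a0 \<preceq>\<^bsub>C\<^esub> a1 \<longrightarrow>
        (\<exists>u\<in>Hom C A (Dom C r0). r0 \<cdot>\<^bsub>C\<^esub> u = a0 \<and> r1 \<cdot>\<^bsub>C\<^esub> u = a1)) \<and>
     (\<exists>d0 d1. is_weak_pullback C r1 r0 d0 d1 \<and>
        (\<exists>\<tau>\<in>Hom C (Dom C d0) (Dom C r0).
           r0 \<cdot>\<^bsub>C\<^esub> \<tau> = r0 \<cdot>\<^bsub>C\<^esub> d0 \<and> r1 \<cdot>\<^bsub>C\<^esub> \<tau> = r1 \<cdot>\<^bsub>C\<^esub> d1)))"

definition ex_maps :: "('o, 'm) pos_cat \<Rightarrow> 'm \<times> 'm \<Rightarrow> 'm \<times> 'm \<Rightarrow> 'm set" where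
  "ex_maps C = (\<lambda>(r0, r1) (s0, s1).
     {f \<in> Hom C (Cod C r0) (Cod C s0).
        \<exists>f'\<in>Hom C (Dom C r0) (Dom C s0). s0 \<cdot>\<^bsub>C\<^esub> f' = f \<cdot>\<^bsub>C\<^esub> r0 \<and> s1 \<cdot>\<^bsub>C\<^esub> f' = f \<cdot>\<^bsub>C\<^esub> r1})"

definition ex_pre :: "('o, 'm) pos_cat \<Rightarrow> 'm \<times> 'm \<Rightarrow> 'm \<Rightarrow> 'm \<Rightarrow> bool" where
  "ex_pre C = (\<lambda>(s0, s1) f g. \<exists>\<sigma>\<in>Hom C (Dom C f) (Dom C s0). s0 \<cdot>\<^bsub>C\<^esub> \<sigma> = f \<and> s1 \<cdot>\<^bsub>C\<^esub> \<sigma> = g)"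

definition ex_equiv :: "('o, 'm) pos_cat \<Rightarrow> 'm \<times> 'm \<Rightarrow> 'm \<times> 'm \<Rightarrow> ('m \<times> 'm) set" where
  "ex_equiv C r s =
     {(f, g). f \<in> ex_maps C r s \<and> g \<in> ex_maps C r s \<and> ex_pre C s f g \<and> ex_pre C s g f}"

text \<open>An arrow is a triple of domain, codomain and equivalence class.  Composition and order are
  stated through representatives; \<open>ex_Comp_class\<close> and \<open>ex_Le_class\<close> below show that they do not
  depend on the choice.\<close>

definition ex_completion ::
  "('o, 'm) pos_cat \<Rightarrow> ('m \<times> 'm, ('m \<times> 'm) \<times> ('m \<times> 'm) \<times> 'm set) pos_cat" where
  "ex_completion C =
     \<lparr>Obj = {r. pseudocongruence C r},
      Arr = {(r, s, F). pseudocongruence C r \<and> pseudocongruence C s \<and>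
                        F \<in> ex_maps C r s // ex_equiv C r s},
      Dom = (\<lambda>(r, s, F). r),
      Cod = (\<lambda>(r, s, F). s),
      Ident = (\<lambda>r. (r, r, ex_equiv C r r `` {Ident C (Cod C (fst r))})),
      Comp = (\<lambda>(s, t, G) (r, s', F).
                (r, t, \<Union>f\<in>F. \<Union>g\<in>G. ex_equiv C r t `` {g \<cdot>\<^bsub>C\<^esub> f})),
      Le = (\<lambda>(r, s, F) (r', s', G). \<exists>f\<in>F. \<exists>g\<in>G. ex_pre C s f g)\<rparr>"


subsection \<open>The definition is sound\<close>

lemma HomD: "f \<in> Hom C x y \<Longrightarrow> f \<in> Arr C \<and> Dom C f = x \<and> Cod C f = y"
  by (simp add: Hom_def)

lemma (in pos_category) Hom_Obj: "f \<in> Hom C x y \<Longrightarrow> x \<in> Obj C \<and> y \<in> Obj C"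
  using Dom_in_Obj Cod_in_Obj by (auto simp: Hom_def)

lemma weak_pullback_lift:
  assumes "is_weak_pullback C f g p q" "A \<in> Obj C" "u \<in> Hom C A (Dom C f)" "v \<in> Hom C A (Dom C g)"
    "f \<cdot>\<^bsub>C\<^esub> u = g \<cdot>\<^bsub>C\<^esub> v"
  shows "\<exists>h\<in>Hom C A (Dom C p). p \<cdot>\<^bsub>C\<^esub> h = u \<and> q \<cdot>\<^bsub>C\<^esub> h = v"
proof -
  have "(u, v) \<in> (\<lambda>h. (p \<cdot>\<^bsub>C\<^esub> h, q \<cdot>\<^bsub>C\<^esub> h)) ` Hom C A (Dom C p)"
    using assms by (auto simp: is_weak_pullback_def)
  then show ?thesis by auto
qed

lemma pseudocongruenceD:
  assumes "pseudocongruence C (r0, r1)"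
  shows "r0 \<in> Hom C (Dom C r0) (Cod C r0)" "r1 \<in> Hom C (Dom C r0) (Cod C r0)"
  using assms by (auto simp: pseudocongruence_def Hom_def)

context pos_category
begin

lemma ex_pre_of_le:
  assumes "pseudocongruence C (s0, s1)" "f \<in> Hom C A (Cod C s0)" "g \<in> Hom C A (Cod C s0)" "f \<preceq> g"
  shows "ex_pre C (s0, s1) f g"
  using assms Hom_Obj[OF assms(2)] by (auto simp: pseudocongruence_def ex_pre_def Hom_def)

lemma ex_pre_refl:
  assumes "pseudocongruence C (s0, s1)" "f \<in> Hom C A (Cod C s0)"
  shows "ex_pre C (s0, s1) f f"
proof -
  have "f \<preceq> f"
    using Hom_poset Hom_Obj[OF assms(2)] assms(2) by (auto simp: poset_on_def reflp_on_def)
  then show ?thesis using ex_pre_of_le assms by blast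
qed

lemma pseudocongruence_trans:
  assumes "pseudocongruence C (s0, s1)"
    and a: "a \<in> Hom C A (Dom C s0)" and b: "b \<in> Hom C A (Dom C s0)" and ab: "s1 \<cdot> a = s0 \<cdot> b"
  shows "\<exists>c\<in>Hom C A (Dom C s0). s0 \<cdot> c = s0 \<cdot> a \<and> s1 \<cdot> c = s1 \<cdot> b"
proof -
  note s = pseudocongruenceD[OF assms(1)]
  obtain d0 d1 \<tau> where wp: "is_weak_pullback C s1 s0 d0 d1"
    and t: "\<tau> \<in> Hom C (Dom C d0) (Dom C s0)" "s0 \<cdot> \<tau> = s0 \<cdot> d0" "s1 \<cdot> \<tau> = s1 \<cdot> d1"
    using assms(1) by (auto simp: pseudocongruence_def)
  have d: "d0 \<in> Hom C (Dom C d0) (Dom C s0)" "d1 \<in> Hom C (Dom C d0) (Dom C s0)"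
    using wp s by (auto simp: is_weak_pullback_def span_over_def Hom_def)
  have "A \<in> Obj C" using Hom_Obj[OF a] by blast
  then obtain h where h: "h \<in> Hom C A (Dom C d0)" "d0 \<cdot> h = a" "d1 \<cdot> h = b"
    using weak_pullback_lift[OF wp _ _ b ab] a HomD[OF s(2)] by auto
  have "s0 \<cdot> (\<tau> \<cdot> h) = s0 \<cdot> a" "s1 \<cdot> (\<tau> \<cdot> h) = s1 \<cdot> b"
    using Comp_assoc[OF h(1) t(1) s(1)] Comp_assoc[OF h(1) t(1) s(2)]
      Comp_assoc[OF h(1) d(1) s(1)] Comp_assoc[OF h(1) d(2) s(2)] t h by simp_all
  then show ?thesis using Comp_in_Hom[OF h(1) t(1)] by blast
qed

lemma pseudocongruence_any_weak_pullback:
  assumes "pseudocongruence C (r0, r1)" "is_weak_pullback C r1 r0 d0 d1"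
  shows "\<exists>\<tau>\<in>Hom C (Dom C d0) (Dom C r0). r0 \<cdot> \<tau> = r0 \<cdot> d0 \<and> r1 \<cdot> \<tau> = r1 \<cdot> d1"
proof -
  have "d0 \<in> Hom C (Dom C d0) (Dom C r0)" "d1 \<in> Hom C (Dom C d0) (Dom C r0)" "r1 \<cdot> d0 = r0 \<cdot> d1"
    using assms(2) pseudocongruenceD[OF assms(1)]
    by (auto simp: is_weak_pullback_def span_over_def Hom_def)
  then show ?thesis by (rule pseudocongruence_trans[OF assms(1)])
qed

lemma ex_pre_trans:
  assumes "pseudocongruence C (s0, s1)" "ex_pre C (s0, s1) f g" "ex_pre C (s0, s1) g h"
    "f \<in> Hom C A B" "g \<in> Hom C A B"
  shows "ex_pre C (s0, s1) f h"
proof -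
  obtain a b where a: "a \<in> Hom C A (Dom C s0)" "s0 \<cdot> a = f" "s1 \<cdot> a = g"
    and b: "b \<in> Hom C A (Dom C s0)" "s0 \<cdot> b = g" "s1 \<cdot> b = h"
    using assms HomD[OF assms(4)] HomD[OF assms(5)] by (auto simp: ex_pre_def)
  have "s1 \<cdot> a = s0 \<cdot> b" using a b by simp
  from pseudocongruence_trans[OF assms(1) a(1) b(1) this]
  show ?thesis using a b HomD[OF assms(4)] by (auto simp: ex_pre_def)
qed

lemma ex_maps_Hom: "f \<in> ex_maps C (r0, r1) (s0, s1) \<Longrightarrow> f \<in> Hom C (Cod C r0) (Cod C s0)"
  by (simp add: ex_maps_def)

lemma ex_maps_Ident:
  assumes "pseudocongruence C (r0, r1)"
  shows "Ident C (Cod C r0) \<in> ex_maps C (r0, r1) (r0, r1)"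
proof -
  note r = pseudocongruenceD[OF assms]
  have "Ident C (Dom C r0) \<in> Hom C (Dom C r0) (Dom C r0)"
    "Ident C (Cod C r0) \<in> Hom C (Cod C r0) (Cod C r0)"
    using Ident_in_Hom Hom_Obj[OF r(1)] by auto
  then show ?thesis
    using Comp_Ident[OF r(1)] Comp_Ident[OF r(2)] Ident_Comp[OF r(1)] Ident_Comp[OF r(2)]
    by (auto simp: ex_maps_def)
qed

lemma ex_maps_Comp:
  assumes p: "pseudocongruence C (r0, r1)" "pseudocongruence C (s0, s1)" "pseudocongruence C (t0, t1)"
    and f: "f \<in> ex_maps C (r0, r1) (s0, s1)" and g: "g \<in> ex_maps C (s0, s1) (t0, t1)"
  shows "g \<cdot> f \<in> ex_maps C (r0, r1) (t0, t1)"
proof -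
  note r = pseudocongruenceD[OF p(1)] and s = pseudocongruenceD[OF p(2)]
    and t = pseudocongruenceD[OF p(3)]
  note fH = ex_maps_Hom[OF f] and gH = ex_maps_Hom[OF g]
  obtain f' g' where f': "f' \<in> Hom C (Dom C r0) (Dom C s0)" "s0 \<cdot> f' = f \<cdot> r0" "s1 \<cdot> f' = f \<cdot> r1"
    and g': "g' \<in> Hom C (Dom C s0) (Dom C t0)" "t0 \<cdot> g' = g \<cdot> s0" "t1 \<cdot> g' = g \<cdot> s1"
    using f g by (auto simp: ex_maps_def)
  have "t0 \<cdot> (g' \<cdot> f') = (g \<cdot> f) \<cdot> r0"
    by (metis Comp_assoc[OF f'(1) g'(1) t(1)] Comp_assoc[OF f'(1) s(1) gH]
        Comp_assoc[OF r(1) fH gH] f' g')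
  moreover have "t1 \<cdot> (g' \<cdot> f') = (g \<cdot> f) \<cdot> r1"
    by (metis Comp_assoc[OF f'(1) g'(1) t(2)] Comp_assoc[OF f'(1) s(2) gH]
        Comp_assoc[OF r(2) fH gH] f' g')
  ultimately show ?thesis
    using Comp_in_Hom[OF fH gH] Comp_in_Hom[OF f'(1) g'(1)] by (auto simp: ex_maps_def)
qed

lemma ex_pre_Comp:
  assumes p: "pseudocongruence C (s0, s1)" "pseudocongruence C (t0, t1)"
    and f: "f \<in> Hom C X (Cod C s0)" "f' \<in> Hom C X (Cod C s0)" "ex_pre C (s0, s1) f f'"
    and g: "g \<in> ex_maps C (s0, s1) (t0, t1)" "g' \<in> ex_maps C (s0, s1) (t0, t1)"
      "ex_pre C (t0, t1) g g'"
  shows "ex_pre C (t0, t1) (g \<cdot> f) (g' \<cdot> f')"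
proof -
  note s = pseudocongruenceD[OF p(1)] and t = pseudocongruenceD[OF p(2)]
  note gH = ex_maps_Hom[OF g(1)] and gH' = ex_maps_Hom[OF g(2)]
  obtain a where a: "a \<in> Hom C X (Dom C s0)" "s0 \<cdot> a = f" "s1 \<cdot> a = f'"
    using f HomD[OF f(1)] by (auto simp: ex_pre_def)
  obtain b where b: "b \<in> Hom C (Cod C s0) (Dom C t0)" "t0 \<cdot> b = g" "t1 \<cdot> b = g'"
    using g HomD[OF gH] by (auto simp: ex_pre_def)
  obtain h where h: "h \<in> Hom C (Dom C s0) (Dom C t0)" "t0 \<cdot> h = g \<cdot> s0" "t1 \<cdot> h = g \<cdot> s1"
    using g by (auto simp: ex_maps_def)
  have "t0 \<cdot> (h \<cdot> a) = g \<cdot> f" "t1 \<cdot> (h \<cdot> a) = g \<cdot> f'"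
    using Comp_assoc[OF a(1) h(1) t(1)] Comp_assoc[OF a(1) s(1) gH]
      Comp_assoc[OF a(1) h(1) t(2)] Comp_assoc[OF a(1) s(2) gH] a h by simp_all
  then have 1: "ex_pre C (t0, t1) (g \<cdot> f) (g \<cdot> f')"
    using Comp_in_Hom[OF a(1) h(1)] HomD[OF Comp_in_Hom[OF f(1) gH]] by (auto simp: ex_pre_def)
  have "t0 \<cdot> (b \<cdot> f') = g \<cdot> f'" "t1 \<cdot> (b \<cdot> f') = g' \<cdot> f'"
    using Comp_assoc[OF f(2) b(1) t(1)] Comp_assoc[OF f(2) b(1) t(2)] b by simp_all
  then have 2: "ex_pre C (t0, t1) (g \<cdot> f') (g' \<cdot> f')"
    using Comp_in_Hom[OF f(2) b(1)] HomD[OF Comp_in_Hom[OF f(2) gH]] by (auto simp: ex_pre_def)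
  show ?thesis
    using ex_pre_trans[OF p(2) 1 2] Comp_in_Hom[OF f(1) gH] Comp_in_Hom[OF f(2) gH] by blast
qed

lemma ex_equiv_equiv:
  assumes p: "pseudocongruence C r" "pseudocongruence C s"
  shows "equiv (ex_maps C r s) (ex_equiv C r s)"
proof -
  obtain r0 r1 s0 s1 where rs: "r = (r0, r1)" "s = (s0, s1)" by fastforce
  note p' = p[unfolded rs]
  show ?thesis
  proof (rule equivI)
    show "ex_equiv C r s \<subseteq> ex_maps C r s \<times> ex_maps C r s"
      by (auto simp: ex_equiv_def)
    show "refl_on (ex_maps C r s) (ex_equiv C r s)"
      unfolding rs refl_on_def
      using ex_pre_refl[OF p'(2)] ex_maps_Hom by (fastforce simp: ex_equiv_def)
    show "sym (ex_equiv C r s)" by (auto simp: sym_def ex_equiv_def)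
    show "trans (ex_equiv C r s)"
      unfolding rs trans_def ex_equiv_def
      using ex_pre_trans[OF p'(2) _ _ ex_maps_Hom ex_maps_Hom] by blast
  qed
qed

lemma ex_class_arr:
  assumes "pseudocongruence C r" "pseudocongruence C s" "f \<in> ex_maps C r s"
  shows "(r, s, ex_equiv C r s `` {f}) \<in> Hom (ex_completion C) r s"
  using assms by (auto simp: Hom_def ex_completion_def quotient_def)

lemma ex_arr_class:
  assumes "\<phi> \<in> Hom (ex_completion C) r s"
  shows "pseudocongruence C r" "pseudocongruence C s"
    "\<exists>f\<in>ex_maps C r s. \<phi> = (r, s, ex_equiv C r s `` {f})"
  using assms by (auto simp: Hom_def ex_completion_def quotient_def)

lemma UN_UN_constant:
  assumes "\<And>a b. a \<in> A \<Longrightarrow> b \<in> B \<Longrightarrow> H a b = K" "a \<in> A" "b \<in> B"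
  shows "(\<Union>a\<in>A. \<Union>b\<in>B. H a b) = K"
  using assms by blast

lemma ex_Comp_class:
  assumes p: "pseudocongruence C r" "pseudocongruence C s" "pseudocongruence C t"
    and f: "f \<in> ex_maps C r s" and g: "g \<in> ex_maps C s t"
  shows "(s, t, ex_equiv C s t `` {g}) \<cdot>\<^bsub>ex_completion C\<^esub> (r, s, ex_equiv C r s `` {f}) =
         (r, t, ex_equiv C r t `` {g \<cdot> f})"
proof -
  obtain r0 r1 s0 s1 t0 t1 where e: "r = (r0, r1)" "s = (s0, s1)" "t = (t0, t1)" by fastforce
  have eq: "ex_equiv C r t `` {g' \<cdot> f'} = ex_equiv C r t `` {g \<cdot> f}"
    if f': "f' \<in> ex_equiv C r s `` {f}" and g': "g' \<in> ex_equiv C s t `` {g}" for f' g'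
  proof -
    have m: "f' \<in> ex_maps C r s" "g' \<in> ex_maps C s t"
      and pr: "ex_pre C s f f'" "ex_pre C s f' f" "ex_pre C t g g'" "ex_pre C t g' g"
      using f' g' by (auto simp: ex_equiv_def)
    note p' = p[unfolded e] and H = ex_maps_Hom[OF f[unfolded e]] ex_maps_Hom[OF m(1)[unfolded e]]
    have "ex_pre C t (g \<cdot> f) (g' \<cdot> f')" "ex_pre C t (g' \<cdot> f') (g \<cdot> f)"
      using ex_pre_Comp[OF p'(2,3) H(1,2)] ex_pre_Comp[OF p'(2,3) H(2,1)] m(2) g pr
      unfolding e by simp_all
    then have "(g' \<cdot> f', g \<cdot> f) \<in> ex_equiv C r t"
      using ex_maps_Comp[OF p' f[unfolded e] g[unfolded e]]
        ex_maps_Comp[OF p' m[unfolded e]] unfolding e ex_equiv_def by simp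
    then show ?thesis using equiv_class_eq[OF ex_equiv_equiv[OF p(1,3)]] by blast
  qed
  have "f \<in> ex_equiv C r s `` {f}" "g \<in> ex_equiv C s t `` {g}"
    using equiv_class_self[OF ex_equiv_equiv[OF p(1,2)] f]
      equiv_class_self[OF ex_equiv_equiv[OF p(2,3)] g] .
  with eq have "(\<Union>f'\<in>ex_equiv C r s `` {f}. \<Union>g'\<in>ex_equiv C s t `` {g}. ex_equiv C r t `` {g' \<cdot> f'}) =
    ex_equiv C r t `` {g \<cdot> f}"
    by (rule UN_UN_constant)
  then show ?thesis unfolding ex_completion_def by (simp only: pos_cat.simps prod.case)
qed

lemma ex_Le_class:
  assumes p: "pseudocongruence C r" "pseudocongruence C s"
    and f: "f \<in> ex_maps C r s" and g: "g \<in> ex_maps C r s"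
  shows "(r, s, ex_equiv C r s `` {f}) \<preceq>\<^bsub>ex_completion C\<^esub> (r, s, ex_equiv C r s `` {g}) \<longleftrightarrow>
         ex_pre C s f g"
proof -
  obtain r0 r1 s0 s1 where e: "r = (r0, r1)" "s = (s0, s1)" by fastforce
  have "f \<in> ex_equiv C r s `` {f}" "g \<in> ex_equiv C r s `` {g}"
    using equiv_class_self[OF ex_equiv_equiv] p f g by blast+
  moreover have "ex_pre C s f g"
    if "f' \<in> ex_equiv C r s `` {f}" "g' \<in> ex_equiv C r s `` {g}" "ex_pre C s f' g'" for f' g'
  proof -
    have m: "f' \<in> ex_maps C r s" "g' \<in> ex_maps C r s" "ex_pre C s f f'" "ex_pre C s g' g"
      using that by (auto simp: ex_equiv_def)
    show ?thesis
      using m that(3) f g p ex_pre_trans ex_maps_Hom unfolding e by meson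
  qed
  ultimately show ?thesis by (auto simp: ex_completion_def)
qed

lemma ex_completion_pos_category: "pos_category (ex_completion C)"
proof
  let ?X = "ex_completion C"
  note arr = ex_arr_class
  have Obj: "r \<in> Obj ?X \<longleftrightarrow> pseudocongruence C r" for r by (simp add: ex_completion_def)
  have Id: "Ident ?X r = (r, r, ex_equiv C r r `` {Ident C (Cod C (fst r))})" for r
    by (simp add: ex_completion_def)
  have Idm: "Ident C (Cod C (fst r)) \<in> ex_maps C r r" if "pseudocongruence C r" for r
    using ex_maps_Ident[of "fst r" "snd r"] that by simp
  have cm: "g \<cdot> f \<in> ex_maps C r t"
    if "pseudocongruence C r" "pseudocongruence C s" "pseudocongruence C t"
      "f \<in> ex_maps C r s" "g \<in> ex_maps C s t" for r s t f g
    using ex_maps_Comp[of "fst r" "snd r" "fst s" "snd s" "fst t" "snd t"] that by simp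
  have mH: "f \<in> Hom C (Cod C (fst r)) (Cod C (fst s))" if "f \<in> ex_maps C r s" for f r s
    using ex_maps_Hom[of f "fst r" "snd r" "fst s" "snd s"] that by simp
  show "Dom ?X \<phi> \<in> Obj ?X" "Cod ?X \<phi> \<in> Obj ?X" if "\<phi> \<in> Arr ?X" for \<phi>
    using that by (auto simp: ex_completion_def)
  show "Ident ?X r \<in> Hom ?X r r" if "r \<in> Obj ?X" for r
    using that ex_class_arr Idm unfolding Obj Id by blast
  show "\<gamma> \<cdot>\<^bsub>?X\<^esub> \<phi> \<in> Hom ?X r t" if h: "\<phi> \<in> Hom ?X r s" "\<gamma> \<in> Hom ?X s t" for \<phi> \<gamma> r s t
  proof -
    note p = arr(1,2)[OF h(1)] arr(2)[OF h(2)]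
    obtain f g where f: "f \<in> ex_maps C r s" "\<phi> = (r, s, ex_equiv C r s `` {f})"
      and g: "g \<in> ex_maps C s t" "\<gamma> = (s, t, ex_equiv C s t `` {g})"
      using arr(3)[OF h(1)] arr(3)[OF h(2)] by blast
    show ?thesis
      unfolding f(2) g(2) ex_Comp_class[OF p f(1) g(1)]
      by (rule ex_class_arr[OF p(1,3) cm[OF p f(1) g(1)]])
  qed
  show "\<phi> \<cdot>\<^bsub>?X\<^esub> Ident ?X r = \<phi>" "Ident ?X s \<cdot>\<^bsub>?X\<^esub> \<phi> = \<phi>" if h: "\<phi> \<in> Hom ?X r s" for \<phi> r s
  proof -
    obtain f where f: "f \<in> ex_maps C r s" "\<phi> = (r, s, ex_equiv C r s `` {f})"
      using arr(3)[OF h] by blast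
    note p = arr(1,2)[OF h]
    show "\<phi> \<cdot>\<^bsub>?X\<^esub> Ident ?X r = \<phi>"
      unfolding f(2) Id ex_Comp_class[OF p(1,1,2) Idm[OF p(1)] f(1)] Comp_Ident[OF mH[OF f(1)]] ..
    show "Ident ?X s \<cdot>\<^bsub>?X\<^esub> \<phi> = \<phi>"
      unfolding f(2) Id ex_Comp_class[OF p(1,2,2) f(1) Idm[OF p(2)]] Ident_Comp[OF mH[OF f(1)]] ..
  qed
  show "(\<eta> \<cdot>\<^bsub>?X\<^esub> \<gamma>) \<cdot>\<^bsub>?X\<^esub> \<phi> = \<eta> \<cdot>\<^bsub>?X\<^esub> (\<gamma> \<cdot>\<^bsub>?X\<^esub> \<phi>)"
    if h: "\<phi> \<in> Hom ?X q r" "\<gamma> \<in> Hom ?X r s" "\<eta> \<in> Hom ?X s t" for \<phi> \<gamma> \<eta> q r s t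
  proof -
    obtain f g k where f: "f \<in> ex_maps C q r" "\<phi> = (q, r, ex_equiv C q r `` {f})"
      and g: "g \<in> ex_maps C r s" "\<gamma> = (r, s, ex_equiv C r s `` {g})"
      and k: "k \<in> ex_maps C s t" "\<eta> = (s, t, ex_equiv C s t `` {k})"
      using arr(3)[OF h(1)] arr(3)[OF h(2)] arr(3)[OF h(3)] by blast
    note p = arr(1,2)[OF h(1)] arr(1,2)[OF h(3)]
    show ?thesis
      unfolding f(2) g(2) k(2) ex_Comp_class[OF p(1,2,3) f(1) g(1)] ex_Comp_class[OF p(2,3,4) g(1) k(1)]
        ex_Comp_class[OF p(1,2,4) f(1) cm[OF p(2,3,4) g(1) k(1)]]
        ex_Comp_class[OF p(1,3,4) cm[OF p(1,2,3) f(1) g(1)] k(1)]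
        Comp_assoc[OF mH[OF f(1)] mH[OF g(1)] mH[OF k(1)]] ..
  qed
  show "poset_on (Hom ?X r s) (Le ?X)" if "r \<in> Obj ?X" "s \<in> Obj ?X" for r s
  proof -
    note p = that[unfolded Obj]
    have p': "pseudocongruence C (fst s, snd s)" using p by simp
    show ?thesis unfolding poset_on_def
    proof (intro conjI)
      show "reflp_on (Hom ?X r s) (Le ?X)"
      proof (rule reflp_onI)
        fix \<phi> assume h: "\<phi> \<in> Hom ?X r s"
        obtain f where f: "f \<in> ex_maps C r s" "\<phi> = (r, s, ex_equiv C r s `` {f})"
          using arr(3)[OF h] by blast
        show "\<phi> \<preceq>\<^bsub>?X\<^esub> \<phi>"
          using ex_Le_class[OF p f(1) f(1)] ex_pre_refl[OF p' mH[OF f(1)]] f(2) by simp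
      qed
      show "antisymp_on (Hom ?X r s) (Le ?X)"
      proof (rule antisymp_onI)
        fix \<phi> \<psi> assume h: "\<phi> \<in> Hom ?X r s" "\<psi> \<in> Hom ?X r s" "\<phi> \<preceq>\<^bsub>?X\<^esub> \<psi>" "\<psi> \<preceq>\<^bsub>?X\<^esub> \<phi>"
        obtain f g where f: "f \<in> ex_maps C r s" "\<phi> = (r, s, ex_equiv C r s `` {f})"
          and g: "g \<in> ex_maps C r s" "\<psi> = (r, s, ex_equiv C r s `` {g})"
          using arr(3)[OF h(1)] arr(3)[OF h(2)] by blast
        have "(f, g) \<in> ex_equiv C r s"
          using h(3,4) ex_Le_class[OF p] f g by (simp add: ex_equiv_def)
        then show "\<phi> = \<psi>"
          using equiv_class_eq[OF ex_equiv_equiv[OF p]] f g by simp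
      qed
      show "transp_on (Hom ?X r s) (Le ?X)"
      proof (rule transp_onI)
        fix \<phi> \<psi> \<chi> assume h: "\<phi> \<in> Hom ?X r s" "\<psi> \<in> Hom ?X r s" "\<chi> \<in> Hom ?X r s"
          "\<phi> \<preceq>\<^bsub>?X\<^esub> \<psi>" "\<psi> \<preceq>\<^bsub>?X\<^esub> \<chi>"
        obtain f g k where f: "f \<in> ex_maps C r s" "\<phi> = (r, s, ex_equiv C r s `` {f})"
          and g: "g \<in> ex_maps C r s" "\<psi> = (r, s, ex_equiv C r s `` {g})"
          and k: "k \<in> ex_maps C r s" "\<chi> = (r, s, ex_equiv C r s `` {k})"
          using arr(3)[OF h(1)] arr(3)[OF h(2)] arr(3)[OF h(3)] by blast
        show "\<phi> \<preceq>\<^bsub>?X\<^esub> \<chi>"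
          using h(4,5) ex_Le_class[OF p] f g k
            ex_pre_trans[OF p' _ _ mH[OF f(1)] mH[OF g(1)], of k] by simp
      qed
    qed
  qed
  show "\<gamma> \<cdot>\<^bsub>?X\<^esub> \<phi> \<preceq>\<^bsub>?X\<^esub> \<gamma>' \<cdot>\<^bsub>?X\<^esub> \<phi>'"
    if h: "\<phi> \<in> Hom ?X r s" "\<phi>' \<in> Hom ?X r s" "\<gamma> \<in> Hom ?X s t" "\<gamma>' \<in> Hom ?X s t"
      "\<phi> \<preceq>\<^bsub>?X\<^esub> \<phi>'" "\<gamma> \<preceq>\<^bsub>?X\<^esub> \<gamma>'" for \<phi> \<phi>' \<gamma> \<gamma>' r s t
  proof -
    note p = arr(1,2)[OF h(1)] arr(2)[OF h(3)]
    obtain f f' g g' where f: "f \<in> ex_maps C r s" "\<phi> = (r, s, ex_equiv C r s `` {f})"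
      and f': "f' \<in> ex_maps C r s" "\<phi>' = (r, s, ex_equiv C r s `` {f'})"
      and g: "g \<in> ex_maps C s t" "\<gamma> = (s, t, ex_equiv C s t `` {g})"
      and g': "g' \<in> ex_maps C s t" "\<gamma>' = (s, t, ex_equiv C s t `` {g'})"
      using arr(3)[OF h(1)] arr(3)[OF h(2)] arr(3)[OF h(3)] arr(3)[OF h(4)] by blast
    have "ex_pre C t (g \<cdot> f) (g' \<cdot> f')"
      using ex_pre_Comp[of "fst s" "snd s" "fst t" "snd t", OF _ _ mH[OF f(1)] mH[OF f'(1)]]
        p h(5,6) f(2) f'(2) g g' ex_Le_class[OF p(1,2) f(1) f'(1)] ex_Le_class[OF p(2,3) g(1) g'(1)]
      by simp
    then show ?thesis
      unfolding f(2) f'(2) g(2) g'(2) ex_Comp_class[OF p f(1) g(1)] ex_Comp_class[OF p f'(1) g'(1)]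
        ex_Le_class[OF p(1,3) cm[OF p f(1) g(1)] cm[OF p f'(1) g'(1)]] .
  qed
qed

end

lemma Hom_full_subcategory:
  "Hom (full_subcategory C P) x y = (if x \<in> P \<and> y \<in> P then Hom C x y else {})"
  by (auto simp: Hom_def full_subcategory_def)

lemma full_subcategory_sel [simp]:
  "Obj (full_subcategory C P) = P" "Dom (full_subcategory C P) = Dom C"
  "Cod (full_subcategory C P) = Cod C" "Ident (full_subcategory C P) = Ident C"
  "Comp (full_subcategory C P) = Comp C" "Le (full_subcategory C P) = Le C"
  by (simp_all add: full_subcategory_def)

lemma pos_category_full_subcategory:
  assumes "pos_category C" "P \<subseteq> Obj C"
  shows "pos_category (full_subcategory C P)"
proof -
  interpret pos_category C by fact
  show ?thesis
  proof
    fix f assume "f \<in> Arr (full_subcategory C P)"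
    then show "Dom (full_subcategory C P) f \<in> Obj (full_subcategory C P)"
      "Cod (full_subcategory C P) f \<in> Obj (full_subcategory C P)"
      by (auto simp: full_subcategory_def)
  next
    fix x assume "x \<in> Obj (full_subcategory C P)"
    then show "Ident (full_subcategory C P) x \<in> Hom (full_subcategory C P) x x"
      using assms(2) Ident_in_Hom by (auto simp: Hom_full_subcategory)
  next
    fix x y assume "x \<in> Obj (full_subcategory C P)" "y \<in> Obj (full_subcategory C P)"
    then show "poset_on (Hom (full_subcategory C P) x y) (Le (full_subcategory C P))"
      using assms(2) Hom_poset by (auto simp: Hom_full_subcategory)
  qed (auto simp: Hom_full_subcategory Comp_in_Hom Comp_Ident Ident_Comp Comp_assoc Comp_mono
         split: if_splits)
qed

lemma projective_cover_weakly_lex: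
  assumes E: "pos_category E" and lim: "has_finite_limits E" and cov: "projective_cover E P"
  shows "weakly_lex (full_subcategory E P)"
proof -
  let ?P = "full_subcategory E P"
  interpret pos_category E by fact
  have PE: "P \<subseteq> Obj E" using cov by (auto simp: projective_cover_def projective_def)
  have "\<exists>L. is_weak_weighted_limit ?P J D W L"
    if W: "finite_weight J W" and D: "pos_functor J ?P D"
    for J :: "(nat, nat) pos_cat" and W :: "(nat, nat, nat) weight" and D
  proof -
    have DP: "\<And>d. d \<in> Obj J \<Longrightarrow> fobj D d \<in> P" using D by (simp add: pos_functor_def)
    have DE: "pos_functor J E D"
      using D E PE DP unfolding pos_functor_def
      by (auto simp: Hom_full_subcategory monotone_on_def)
    have cones: "wcones ?P J D W X = wcones E J D W X" if "X \<in> P" for X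
      using that DP unfolding wcones_def by (auto simp: Hom_full_subcategory PiE_iff)
    have cc: "wcone_comp ?P J W = wcone_comp E J W" by (auto simp: wcone_comp_def fun_eq_iff)
    obtain L \<Phi> where L: "L \<in> Obj E"
      and iso: "\<And>X. X \<in> Obj E \<Longrightarrow>
        poset_iso (Hom E X L) (Le E) (wcones E J D W X) (wcone_le E J W) (\<Phi> X)"
      and nat: "\<And>X Y f h. \<lbrakk>X \<in> Obj E; Y \<in> Obj E; f \<in> Hom E Y X; h \<in> Hom E X L\<rbrakk> \<Longrightarrow>
        \<Phi> Y (h \<cdot>\<^bsub>E\<^esub> f) = wcone_comp E J W (\<Phi> X h) f"
      using lim W DE unfolding has_finite_limits_def is_weighted_limit_def by metis
    obtain Q e where Q: "Q \<in> P" and e: "e \<in> Hom E Q L" "so_morphism E e"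
      using cov L unfolding projective_cover_def by blast
    define \<kappa> where "\<kappa> = \<Phi> Q e"
    have QE: "Q \<in> Obj E" using Q PE by blast
    have \<kappa>: "\<kappa> \<in> wcones E J D W Q"
      using iso[OF QE] e(1) unfolding poset_iso_def \<kappa>_def by (meson bij_betwE)
    have surj: "wcone_comp E J W \<kappa> ` Hom E X Q = wcones E J D W X" if X: "X \<in> P" for X
    proof -
      have XE: "X \<in> Obj E" using X PE by blast
      have proj: "(\<lambda>h. e \<cdot>\<^bsub>E\<^esub> h) ` Hom E X Q = Hom E X L"
        using cov X e HomD[OF e(1)] by (auto simp: projective_cover_def projective_def)
      have "wcones E J D W X = \<Phi> X ` Hom E X L"
        using iso[OF XE] by (simp add: poset_iso_def bij_betw_def)
      also have "\<dots> = (\<lambda>h. \<Phi> X (e \<cdot>\<^bsub>E\<^esub> h)) ` Hom E X Q"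
        unfolding proj[symmetric] by (simp add: image_image)
      also have "\<dots> = wcone_comp E J W \<kappa> ` Hom E X Q"
        using nat[OF QE XE _ e(1)] unfolding \<kappa>_def by (intro image_cong) auto
      finally show ?thesis by simp
    qed
    have "is_weak_weighted_limit ?P J D W Q"
      unfolding is_weak_weighted_limit_def
      using Q \<kappa> surj by (auto simp: cones cc Hom_full_subcategory)
    then show ?thesis by blast
  qed
  then show ?thesis
    using pos_category_full_subcategory[OF E PE] by (simp add: weakly_lex_def)
qed

end

theory Submission
  imports Defs
begin

text \<open>Call \<open>q : X \<rightarrow> B\<close> a presentation of a pseudocongruence \<open>r : R \<rightarrow> X \<times> X\<close> in \<open>\<P>\<close> if it is an
  so-morphism and, for \<open>a, b : A \<rightarrow> X\<close> with \<open>A \<in> \<P>\<close>, \<open>q a \<le> q b\<close> holds iff \<open>(a, b)\<close> factors through \<open>r\<close>.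
  Every object \<open>B\<close> has a presentation: cover \<open>B\<close>, then cover the kernel congruence of that cover. Every
  pseudocongruence has one: its image is a congruence in \<open>\<E>\<close>, which is effective. As so-morphisms are
  quotients of their kernels and objects of \<open>\<P>\<close> are projective, maps between presented
  pseudocongruences, modulo the equivalence, correspond to maps between the presented objects. So the
  presentations form a span of fully faithful functors, surjective on objects, between \<open>\<P>\<^sub>e\<^sub>x\<close> and \<open>\<E>\<close>.\<close>

section \<open>Equivalences from spans of fully faithful functors\<close>

text \<open>The elements of \<open>T\<close> are the objects of the apex of the span. Its arrows
  need no separate type: an arrow from \<open>s\<close> to \<open>t\<close> can be taken in
  \<open>Hom A (a s) (a t)\<close>, and \<open>K s t\<close> transports it to the other leg. Both
  legs are surjective on objects on the nose, so each has a section, and going back along one leg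
  and forward along the other gives the two functors.\<close>

lemma equivalent_categories_of_span:
  fixes A :: "('o, 'm) pos_cat" and B :: "('p, 'n) pos_cat"
  assumes A: "pos_category A" and B: "pos_category B"
    and sA: "a ` T = Obj A" and sB: "b ` T = Obj B"
    and iso: "\<And>s t. s \<in> T \<Longrightarrow> t \<in> T \<Longrightarrow>
      poset_iso (Hom A (a s) (a t)) (Le A) (Hom B (b s) (b t)) (Le B) (K s t)"
    and K_Ident: "\<And>t. t \<in> T \<Longrightarrow> K t t (Ident A (a t)) = Ident B (b t)"
    and K_Comp: "\<And>r s t f g. \<lbrakk>r \<in> T; s \<in> T; t \<in> T; f \<in> Hom A (a r) (a s); g \<in> Hom A (a s) (a t)\<rbrakk>
      \<Longrightarrow> K r t (g \<cdot>\<^bsub>A\<^esub> f) = K s t g \<cdot>\<^bsub>B\<^esub> K r s f"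
  shows "equivalent_categories A B"
proof -
  interpret A: pos_category A by fact
  interpret B: pos_category B by fact
  \<comment> \<open>Chosen sections of the two legs on objects.\<close>
  define p where "p = inv_into T a"
  define q where "q = inv_into T b"
  have p: "p x \<in> T" "a (p x) = x" if "x \<in> Obj A" for x
    using that unfolding p_def sA[symmetric] by (auto intro: inv_into_into f_inv_into_f)
  have q: "q y \<in> T" "b (q y) = y" if "y \<in> Obj B" for y
    using that unfolding q_def sB[symmetric] by (auto intro: inv_into_into f_inv_into_f)
  have aT: "a t \<in> Obj A" and bT: "b t \<in> Obj B" if "t \<in> T" for t
    using that sA sB by auto
  \<comment> \<open>\<open>L\<close> inverts \<open>K\<close> on each hom-set. It inherits
    preservation of identities and composites, and it is monotone because \<open>K\<close> reflects
    the order.\<close>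
  define L where "L s t = inv_into (Hom A (a s) (a t)) (K s t)" for s t
  have KH: "K s t f \<in> Hom B (b s) (b t)" if "s \<in> T" "t \<in> T" "f \<in> Hom A (a s) (a t)" for s t f
    using iso[OF that(1,2)] that(3) by (auto simp: poset_iso_def dest: bij_betwE)
  have LK: "L s t (K s t f) = f" if "s \<in> T" "t \<in> T" "f \<in> Hom A (a s) (a t)" for s t f
    using iso[OF that(1,2)] that(3) by (auto simp: poset_iso_def L_def bij_betw_def)
  have LH: "L s t h \<in> Hom A (a s) (a t)" and KL: "K s t (L s t h) = h"
    if "s \<in> T" "t \<in> T" "h \<in> Hom B (b s) (b t)" for s t h
    using iso[OF that(1,2)] that(3) unfolding poset_iso_def L_def bij_betw_def
    by (auto intro: inv_into_into f_inv_into_f)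
  have Kle: "f \<preceq>\<^bsub>A\<^esub> g \<longleftrightarrow> K s t f \<preceq>\<^bsub>B\<^esub> K s t g"
    if "s \<in> T" "t \<in> T" "f \<in> Hom A (a s) (a t)" "g \<in> Hom A (a s) (a t)" for s t f g
    using iso[OF that(1,2)] that(3,4) by (auto simp: poset_iso_def)
  have L_Ident: "L t t (Ident B (b t)) = Ident A (a t)" if "t \<in> T" for t
    using LK[OF that that] A.Ident_in_Hom[OF aT[OF that]] K_Ident[OF that] by metis
  have L_Comp: "L r t (g \<cdot>\<^bsub>B\<^esub> f) = L s t g \<cdot>\<^bsub>A\<^esub> L r s f"
    if t: "r \<in> T" "s \<in> T" "t \<in> T" and f: "f \<in> Hom B (b r) (b s)" and g: "g \<in> Hom B (b s) (b t)"
    for r s t f g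
    using K_Comp[OF t LH[OF t(1,2) f] LH[OF t(2,3) g]] KL[OF t(1,2) f] KL[OF t(2,3) g]
      LK[OF t(1,3) A.Comp_in_Hom[OF LH[OF t(1,2) f] LH[OF t(2,3) g]]] by simp
  \<comment> \<open>\<open>farr\<close> sees only an arrow, so the indices of \<open>K\<close> and
    \<open>L\<close> are recovered from its domain and codomain.\<close>
  define F where "F = \<lparr>fobj = \<lambda>x. b (p x), farr = \<lambda>f. K (p (Dom A f)) (p (Cod A f)) f\<rparr>"
  define G where "G = \<lparr>fobj = \<lambda>y. a (q y), farr = \<lambda>h. L (q (Dom B h)) (q (Cod B h)) h\<rparr>"
  have F: "fobj F x = b (p x)" "f \<in> Hom A x y \<Longrightarrow> farr F f = K (p x) (p y) f" for x y f
    by (auto simp: F_def Hom_def)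
  have G: "fobj G x = a (q x)" "h \<in> Hom B x y \<Longrightarrow> farr G h = L (q x) (q y) h" for x y h
    by (auto simp: G_def Hom_def)
  have AH: "f \<in> Hom A (a (p x)) (a (p y))" if "f \<in> Hom A x y" for f x y
    using that p(2) A.Hom_Obj by metis
  have BH: "f \<in> Hom B (b (q x)) (b (q y))" if "f \<in> Hom B x y" for f x y
    using that q(2) B.Hom_Obj by metis
  have fF: "pos_functor A B F"
    unfolding pos_functor_def
  proof (intro conjI ballI)
    show "fobj F x \<in> Obj B" if "x \<in> Obj A" for x
      using bT p(1)[OF that] by (simp add: F)
    show "farr F f \<in> Hom B (fobj F x) (fobj F y)"
      if "x \<in> Obj A" "y \<in> Obj A" "f \<in> Hom A x y" for x y f
      using KH[OF p(1) p(1) AH] that by (simp add: F)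
    show "farr F (Ident A x) = Ident B (fobj F x)" if "x \<in> Obj A" for x
      using K_Ident[OF p(1)[OF that]] p(2)[OF that] A.Ident_in_Hom[OF that] by (simp add: F)
    show "farr F (g \<cdot>\<^bsub>A\<^esub> f) = farr F g \<cdot>\<^bsub>B\<^esub> farr F f"
      if "x \<in> Obj A" "y \<in> Obj A" "z \<in> Obj A" "f \<in> Hom A x y" "g \<in> Hom A y z" for x y z f g
      using K_Comp[OF p(1) p(1) p(1) AH AH] that A.Comp_in_Hom[OF that(4,5)] by (simp add: F)
    show "monotone_on (Hom A x y) (Le A) (Le B) (farr F)"
      if "x \<in> Obj A" "y \<in> Obj A" for x y
      using Kle[OF p(1) p(1) AH AH] that by (auto simp: F monotone_on_def)
  qed fact+
  have fG: "pos_functor B A G"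
    unfolding pos_functor_def
  proof (intro conjI ballI)
    show "fobj G x \<in> Obj A" if "x \<in> Obj B" for x
      using aT q(1)[OF that] by (simp add: G)
    show "farr G f \<in> Hom A (fobj G x) (fobj G y)"
      if "x \<in> Obj B" "y \<in> Obj B" "f \<in> Hom B x y" for x y f
      using LH[OF q(1) q(1) BH] that by (simp add: G)
    show "farr G (Ident B x) = Ident A (fobj G x)" if "x \<in> Obj B" for x
      using L_Ident[OF q(1)[OF that]] q(2)[OF that] B.Ident_in_Hom[OF that] by (simp add: G)
    show "farr G (g \<cdot>\<^bsub>B\<^esub> f) = farr G g \<cdot>\<^bsub>A\<^esub> farr G f"
      if "x \<in> Obj B" "y \<in> Obj B" "z \<in> Obj B" "f \<in> Hom B x y" "g \<in> Hom B y z" for x y z f g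
      using L_Comp[OF q(1) q(1) q(1) BH BH] that B.Comp_in_Hom[OF that(4,5)] by (simp add: G)
    show "monotone_on (Hom B x y) (Le B) (Le A) (farr G)"
      if o: "x \<in> Obj B" "y \<in> Obj B" for x y
    proof (rule monotone_onI)
      fix f g assume h: "f \<in> Hom B x y" "g \<in> Hom B x y" "f \<preceq>\<^bsub>B\<^esub> g"
      note qs = q(1)[OF o(1)] q(1)[OF o(2)]
      show "farr G f \<preceq>\<^bsub>A\<^esub> farr G g"
        using Kle[OF qs LH[OF qs BH[OF h(1)]] LH[OF qs BH[OF h(2)]]] KL[OF qs BH] h by (simp add: G)
    qed
  qed fact+
  \<comment> \<open>The elements \<open>p x\<close> and \<open>q (b (p x))\<close> of
    \<open>T\<close> have the same image under \<open>b\<close>. The identity of that image, read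
    through \<open>L\<close>, is an arrow between their images under \<open>a\<close>, namely from
    \<open>x\<close> to its round trip. Dually for \<open>\<epsilon>\<close>.\<close>
  define \<eta> where "\<eta> x = L (p x) (q (b (p x))) (Ident B (b (p x)))" for x
  define \<epsilon> where "\<epsilon> y = K (p (a (q y))) (q y) (Ident A (a (q y)))" for y
  \<comment> \<open>The inverse is the same identity read through \<open>L\<close> with the indices
    swapped.\<close>
  have isoA: "iso_arrow A (L s t h)"
    if st: "s \<in> T" "t \<in> T" "b t = b s" "h = Ident B (b s)" for s t h
  proof -
    have I: "h \<in> Hom B (b s) (b t)" "h \<in> Hom B (b t) (b s)" "h \<cdot>\<^bsub>B\<^esub> h = h"
      using B.Ident_in_Hom[OF bT[OF st(1)]] st(3,4) B.Comp_Ident by auto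
    show ?thesis
      using HomD[OF LH[OF st(1,2) I(1)]] LH[OF st(2,1) I(2)] L_Comp[OF st(1,2,1) I(1,2)]
        L_Comp[OF st(2,1,2) I(2,1)] L_Ident[OF st(1)] L_Ident[OF st(2)] st(3,4) I(3)
      unfolding iso_arrow_def by auto
  qed
  have isoB: "iso_arrow B (K s t h)"
    if st: "s \<in> T" "t \<in> T" "a t = a s" "h = Ident A (a s)" for s t h
  proof -
    have I: "h \<in> Hom A (a s) (a t)" "h \<in> Hom A (a t) (a s)" "h \<cdot>\<^bsub>A\<^esub> h = h"
      using A.Ident_in_Hom[OF aT[OF st(1)]] st(3,4) A.Comp_Ident by auto
    show ?thesis
      using HomD[OF KH[OF st(1,2) I(1)]] KH[OF st(2,1) I(2)] K_Comp[OF st(1,2,1) I(1,2)]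
        K_Comp[OF st(2,1,2) I(2,1)] K_Ident[OF st(1)] K_Ident[OF st(2)] st(3,4) I(3)
      unfolding iso_arrow_def by auto
  qed
  have \<eta>: "natural_iso A A id_fun (comp_fun G F) \<eta>"
    unfolding natural_iso_def id_fun_def comp_fun_def pos_fun.simps o_apply
  proof (intro conjI ballI)
    fix x assume x: "x \<in> Obj A"
    note P = p[OF x] and Q = q[OF bT[OF p(1)[OF x]]]
    show "\<eta> x \<in> Hom A x (fobj G (fobj F x))"
      using LH[OF P(1) Q(1)] Q(2) P(2) B.Ident_in_Hom[OF bT[OF P(1)]] by (simp add: F G \<eta>_def)
    show "iso_arrow A (\<eta> x)" unfolding \<eta>_def by (rule isoA[OF P(1) Q(1,2) refl])
    fix y f assume y: "y \<in> Obj A" and f: "f \<in> Hom A x y"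
    note P' = p[OF y] and Q' = q[OF bT[OF p(1)[OF y]]]
    have f': "f \<in> Hom A (a (p x)) (a (p y))" using AH[OF f] .
    note k = KH[OF P(1) P'(1) f']
    have I: "Ident B (b (p x)) \<in> Hom B (b (p x)) (b (q (b (p x))))"
      "Ident B (b (p y)) \<in> Hom B (b (p y)) (b (q (b (p y))))"
      using Q Q' B.Ident_in_Hom bT P(1) P'(1) by auto
    have "farr G (farr F f) \<cdot>\<^bsub>A\<^esub> \<eta> x = L (p x) (q (b (p y))) (K (p x) (p y) f \<cdot>\<^bsub>B\<^esub> Ident B (b (p x)))"
      unfolding F(2)[OF f] G(2)[OF k] \<eta>_def
      by (rule L_Comp[OF P(1) Q(1) Q'(1) I(1) BH[OF k], symmetric])
    also have "\<dots> = L (p x) (q (b (p y))) (Ident B (b (p y)) \<cdot>\<^bsub>B\<^esub> K (p x) (p y) f)"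
      using B.Comp_Ident[OF k] B.Ident_Comp[OF k] by simp
    also have "\<dots> = \<eta> y \<cdot>\<^bsub>A\<^esub> f"
      using L_Comp[OF P(1) P'(1) Q'(1) k I(2)] LK[OF P(1) P'(1) f'] by (simp add: \<eta>_def)
    finally show "farr G (farr F f) \<cdot>\<^bsub>A\<^esub> \<eta> x = \<eta> y \<cdot>\<^bsub>A\<^esub> f" .
  qed
  have \<epsilon>: "natural_iso B B (comp_fun F G) id_fun \<epsilon>"
    unfolding natural_iso_def id_fun_def comp_fun_def pos_fun.simps o_apply
  proof (intro conjI ballI)
    fix x assume x: "x \<in> Obj B"
    note Q = q[OF x] and P = p[OF aT[OF q(1)[OF x]]]
    show "\<epsilon> x \<in> Hom B (fobj F (fobj G x)) x"
      using KH[OF P(1) Q(1)] Q(2) P(2) A.Ident_in_Hom[OF aT[OF Q(1)]] by (simp add: F G \<epsilon>_def)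
    show "iso_arrow B (\<epsilon> x)" unfolding \<epsilon>_def by (rule isoB) (use P Q in auto)
    fix y f assume y: "y \<in> Obj B" and f: "f \<in> Hom B x y"
    note Q' = q[OF y] and P' = p[OF aT[OF q(1)[OF y]]]
    have f': "f \<in> Hom B (b (q x)) (b (q y))" using BH[OF f] .
    note k = LH[OF Q(1) Q'(1) f']
    have I: "Ident A (a (q x)) \<in> Hom A (a (p (a (q x)))) (a (q x))"
      "Ident A (a (q y)) \<in> Hom A (a (p (a (q y)))) (a (q y))"
      using P P' A.Ident_in_Hom aT Q(1) Q'(1) by auto
    have "f \<cdot>\<^bsub>B\<^esub> \<epsilon> x = K (p (a (q x))) (q y) (L (q x) (q y) f \<cdot>\<^bsub>A\<^esub> Ident A (a (q x)))"
      using K_Comp[OF P(1) Q(1) Q'(1) I(1) k] KL[OF Q(1) Q'(1) f'] by (simp add: \<epsilon>_def)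
    also have "\<dots> = K (p (a (q x))) (q y) (Ident A (a (q y)) \<cdot>\<^bsub>A\<^esub> L (q x) (q y) f)"
      using A.Comp_Ident[OF k] A.Ident_Comp[OF k] by simp
    also have "\<dots> = \<epsilon> y \<cdot>\<^bsub>B\<^esub> farr F (farr G f)"
      unfolding F(2)[OF k] G(2)[OF f] \<epsilon>_def
      by (rule K_Comp[OF P(1) P'(1) Q'(1) AH[OF k] I(2)])
    finally show "f \<cdot>\<^bsub>B\<^esub> \<epsilon> x = \<epsilon> y \<cdot>\<^bsub>B\<^esub> farr F (farr G f)" .
  qed
  show ?thesis unfolding equivalent_categories_def using fF fG \<eta> \<epsilon> by blast
qed


section \<open>Finite limits\<close>

text \<open>Yoneda: naturality forces \<open>\<Phi> X h\<close> to be the cone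
  \<open>\<Phi> L (Ident C L)\<close> composed with \<open>h\<close>. The representing isomorphism
  is thereby replaced by one universal cone, through which every cone factors and which reflects the
  order.\<close>

lemma weighted_limit_cone:
  assumes C: "pos_category C" and lim: "is_weighted_limit C J D W L"
  obtains \<kappa> where "\<kappa> \<in> wcones C J D W L"
    "\<And>X. X \<in> Obj C \<Longrightarrow> wcone_comp C J W \<kappa> ` Hom C X L = wcones C J D W X"
    "\<And>X h h'. \<lbrakk>h \<in> Hom C X L; h' \<in> Hom C X L;
       wcone_le C J W (wcone_comp C J W \<kappa> h) (wcone_comp C J W \<kappa> h')\<rbrakk> \<Longrightarrow> h \<preceq>\<^bsub>C\<^esub> h'"
proof -
  interpret pos_category C by fact
  obtain \<Phi> where L: "L \<in> Obj C"
    and iso: "\<And>X. X \<in> Obj C \<Longrightarrow> poset_iso (Hom C X L) (Le C) (wcones C J D W X) (wcone_le C J W) (\<Phi> X)"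
    and nat: "\<And>X Y f h. \<lbrakk>X \<in> Obj C; Y \<in> Obj C; f \<in> Hom C Y X; h \<in> Hom C X L\<rbrakk> \<Longrightarrow>
        \<Phi> Y (h \<cdot>\<^bsub>C\<^esub> f) = wcone_comp C J W (\<Phi> X h) f"
    using lim unfolding is_weighted_limit_def by metis
  note I = Ident_in_Hom[OF L]
  have \<Phi>: "\<Phi> X h = wcone_comp C J W (\<Phi> L (Ident C L)) h" if "h \<in> Hom C X L" for X h
    using nat[OF L _ that I] Ident_Comp[OF that] Hom_Obj[OF that] by simp
  show thesis
  proof
    show "\<Phi> L (Ident C L) \<in> wcones C J D W L"
      using iso[OF L] I by (auto simp: poset_iso_def dest: bij_betwE)
    show "wcone_comp C J W (\<Phi> L (Ident C L)) ` Hom C X L = wcones C J D W X" if "X \<in> Obj C" for X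
      using iso[OF that] \<Phi>[of _ X] by (simp add: poset_iso_def bij_betw_def cong: image_cong)
    show "h \<preceq>\<^bsub>C\<^esub> h'" if "h \<in> Hom C X L" "h' \<in> Hom C X L"
       "wcone_le C J W (wcone_comp C J W (\<Phi> L (Ident C L)) h) (wcone_comp C J W (\<Phi> L (Ident C L)) h')"
     for X h h'
      using iso[of X] \<Phi>[OF that(1)] \<Phi>[OF that(2)] Hom_Obj[OF that(1)] that
      by (auto simp: poset_iso_def)
  qed
qed

section \<open>Hom-posets; products and inserters as weighted limits\<close>

context pos_category
begin

lemma le_refl: "f \<in> Hom C x y \<Longrightarrow> f \<preceq> f"
  using Hom_poset[of x y] Hom_Obj[of f x y] by (auto simp: poset_on_def reflp_on_def)

lemma le_antisym: "f \<in> Hom C x y \<Longrightarrow> g \<in> Hom C x y \<Longrightarrow> f \<preceq> g \<Longrightarrow> g \<preceq> f \<Longrightarrow> f = g"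
  using Hom_poset[of x y] Hom_Obj[of f x y] by (auto simp: poset_on_def antisymp_on_def)

lemma le_trans:
  "f \<in> Hom C x y \<Longrightarrow> g \<in> Hom C x y \<Longrightarrow> h \<in> Hom C x y \<Longrightarrow> f \<preceq> g \<Longrightarrow> g \<preceq> h \<Longrightarrow> f \<preceq> h"
  using Hom_poset[of x y] Hom_Obj[of f x y] unfolding poset_on_def transp_on_def by blast

lemma Comp_mono_right:
  "f \<in> Hom C x y \<Longrightarrow> f' \<in> Hom C x y \<Longrightarrow> g \<in> Hom C y z \<Longrightarrow> f \<preceq> f' \<Longrightarrow> g \<cdot> f \<preceq> g \<cdot> f'"
  using Comp_mono le_refl by blast

lemma Comp_mono_left:
  "f \<in> Hom C x y \<Longrightarrow> g \<in> Hom C y z \<Longrightarrow> g' \<in> Hom C y z \<Longrightarrow> g \<preceq> g' \<Longrightarrow> g \<cdot> f \<preceq> g' \<cdot> f"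
  using Comp_mono le_refl by blast

lemma exists_product:
  assumes lim: "has_finite_limits C" and X: "X \<in> Obj C" and Y: "Y \<in> Obj C"
  shows "\<exists>Q p q. is_product C X Y Q p q"
proof -
  \<comment> \<open>The discrete category on two objects, each arrow being named by its object. With
    one-point weights a cone is just a pair of arrows into \<open>X\<close> and
    \<open>Y\<close>.\<close>
  define J :: "(nat, nat) pos_cat" where
    "J = \<lparr>Obj = {0, 1}, Arr = {0, 1}, Dom = id, Cod = id, Ident = id, Comp = (\<lambda>g f. f), Le = (=)\<rparr>"
  define W :: "(nat, nat, nat) weight" where
    "W = \<lparr>wcar = (\<lambda>_. {0}), wle = (\<lambda>_. (=)), wmap = (\<lambda>_ w. w)\<rparr>"
  define D where "D = \<lparr>fobj = (\<lambda>d::nat. if d = 0 then X else Y),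
    farr = (\<lambda>d::nat. Ident C (if d = 0 then X else Y))\<rparr>"
  have Js: "Obj J = {0, 1}" "Dom J = id" "Cod J = id" "Ident J = id" "Comp J = (\<lambda>g f. f)" "Le J = (=)"
    by (simp_all add: J_def)
  note defs = Js W_def D_def
  have HJ: "f \<in> Hom J d d' \<longleftrightarrow> d = d' \<and> f = d \<and> d \<in> {0, 1}" for f d d'
    by (auto simp: Hom_def J_def)
  have fin: "finite (Hom J d d')" for d d'
    by (rule finite_subset[of _ "{0, 1}"]) (auto simp: HJ)
  have J: "pos_category J"
    by unfold_locales
      (auto simp: HJ poset_on_def reflp_on_def antisymp_on_def transp_on_def, auto simp: J_def HJ)
  have W: "finite_weight J W"
    using J fin unfolding finite_weight_def is_weight_def
    by (auto simp: HJ defs poset_on_def reflp_on_def antisymp_on_def transp_on_def monotone_on_def)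
  have D: "pos_functor J C D"
    using J pos_category_axioms X Y Ident_in_Hom Comp_Ident[OF Ident_in_Hom] Hom_poset
    unfolding pos_functor_def
    by (auto simp: HJ defs monotone_on_def poset_on_def reflp_on_def)
  obtain L where L: "is_weighted_limit C J D W L"
    using lim W D unfolding has_finite_limits_def by blast
  obtain \<kappa> where \<kappa>: "\<kappa> \<in> wcones C J D W L"
    and surj: "\<And>A. A \<in> Obj C \<Longrightarrow> wcone_comp C J W \<kappa> ` Hom C A L = wcones C J D W A"
    and le: "\<And>A h h'. \<lbrakk>h \<in> Hom C A L; h' \<in> Hom C A L;
       wcone_le C J W (wcone_comp C J W \<kappa> h) (wcone_comp C J W \<kappa> h')\<rbrakk> \<Longrightarrow> h \<preceq>\<^bsub>C\<^esub> h'"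
    using weighted_limit_cone[OF pos_category_axioms L] by metis
  define p q where "p = \<kappa> 0 0" and "q = \<kappa> 1 0"
  have p: "p \<in> Hom C L X" and q: "q \<in> Hom C L Y"
    using \<kappa> by (auto simp: wcones_def defs p_def q_def PiE_iff)
  have LO: "L \<in> Obj C" using Hom_Obj[OF p] by blast
  have ex: "\<exists>h\<in>Hom C A L. p \<cdot> h = x \<and> q \<cdot> h = y" if x: "x \<in> Hom C A X" and y: "y \<in> Hom C A Y" for A x y
  proof -
    define \<phi> where "\<phi> = (\<lambda>d\<in>Obj J. \<lambda>w\<in>wcar W d. if d = 0 then x else y)"
    have "\<phi> \<in> wcones C J D W A"
      using x y Ident_Comp[OF x] Ident_Comp[OF y] Hom_poset X Y Hom_Obj[OF x]
      unfolding wcones_def \<phi>_def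
      by (auto simp: HJ defs monotone_on_def poset_on_def reflp_on_def)
    then obtain h where h: "h \<in> Hom C A L" "\<phi> = wcone_comp C J W \<kappa> h"
      using surj Hom_Obj[OF x] by blast
    have "p \<cdot> h = x" "q \<cdot> h = y"
      using fun_cong[OF fun_cong[OF h(2), of 0], of 0] fun_cong[OF fun_cong[OF h(2), of 1], of 0]
      by (simp_all add: \<phi>_def wcone_comp_def p_def q_def defs)
    then show ?thesis using h by blast
  qed
  have le: "h \<preceq> h' \<longleftrightarrow> p \<cdot> h \<preceq> p \<cdot> h' \<and> q \<cdot> h \<preceq> q \<cdot> h'"
    if h: "h \<in> Hom C A L" "h' \<in> Hom C A L" for A h h'
  proof
    assume "h \<preceq> h'"
    then show "p \<cdot> h \<preceq> p \<cdot> h' \<and> q \<cdot> h \<preceq> q \<cdot> h'"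
      using Comp_mono[OF h p p] Comp_mono[OF h q q] p q Hom_poset LO X Y
      by (auto simp: poset_on_def reflp_on_def)
  next
    assume "p \<cdot> h \<preceq> p \<cdot> h' \<and> q \<cdot> h \<preceq> q \<cdot> h'"
    then show "h \<preceq> h'"
      by (intro le[OF h]) (auto simp: wcone_le_def wcone_comp_def defs p_def q_def)
  qed
  have "poset_iso (Hom C A L) (Le C) (Hom C A X \<times> Hom C A Y) (rel_prod (Le C) (Le C))
    (\<lambda>h. (p \<cdot> h, q \<cdot> h))" if A: "A \<in> Obj C" for A
    unfolding poset_iso_def bij_betw_def
  proof (intro conjI ballI inj_onI)
    fix h h' assume h: "h \<in> Hom C A L" "h' \<in> Hom C A L"
    show "h \<preceq> h' \<longleftrightarrow> rel_prod (Le C) (Le C) (p \<cdot> h, q \<cdot> h) (p \<cdot> h', q \<cdot> h')"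
      using le[OF h] by simp
    have "h \<preceq> h" using Hom_poset[OF A LO] h by (auto simp: poset_on_def reflp_on_def)
    moreover assume "(p \<cdot> h, q \<cdot> h) = (p \<cdot> h', q \<cdot> h')"
    ultimately have "h \<preceq> h' \<and> h' \<preceq> h" using le[OF h] le[OF h(2,1)] le[OF h(1,1)] by simp
    then show "h = h'" using Hom_poset[OF A LO] h by (auto simp: poset_on_def antisymp_on_def)
  next
    show "(\<lambda>h. (p \<cdot> h, q \<cdot> h)) ` Hom C A L = Hom C A X \<times> Hom C A Y"
      using ex Comp_in_Hom[OF _ p] Comp_in_Hom[OF _ q] by force
  qed
  then have "is_product C X Y L p q"
    using X Y LO p q by (auto simp: is_product_def)
  then show ?thesis by blast
qed

text \<open>Turning an inequality between parallel arrows into a factorization is the basic enriched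
  limit here: weak commas, weak pullbacks and the order-epi property of so-morphisms are all derived
  from it.\<close>

lemma exists_inserter:
  assumes lim: "has_finite_limits C" and u: "u \<in> Hom C A B" and v: "v \<in> Hom C A B"
  obtains I w where "w \<in> Hom C I A" "order_mono C w" "u \<cdot> w \<preceq> v \<cdot> w"
    "\<And>X x. \<lbrakk>x \<in> Hom C X A; u \<cdot> x \<preceq> v \<cdot> x\<rbrakk> \<Longrightarrow> \<exists>y\<in>Hom C X I. w \<cdot> y = x"
proof -
  have AO: "A \<in> Obj C" and BO: "B \<in> Obj C" using Hom_Obj[OF u] by auto
  \<comment> \<open>The parallel pair: \<open>0\<close> and \<open>1\<close> name the objects and
    their identities, \<open>2\<close> and \<open>3\<close> the two arrows from \<open>0\<close> to
    \<open>1\<close>. The weight is a point at \<open>0\<close> and the chain \<open>0 < 1\<close>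
    at \<open>1\<close>, with arrow \<open>2\<close> picking the bottom and arrow \<open>3\<close>
    the top. A cone is then an arrow \<open>x\<close> into \<open>A\<close> together with the
    inequality \<open>u \<cdot> x \<preceq> v \<cdot> x\<close>.\<close>
  define J :: "(nat, nat) pos_cat" where
    "J = \<lparr>Obj = {0, 1}, Arr = {0, 1, 2, 3}, Dom = (\<lambda>f. if f = 1 then 1 else 0),
      Cod = (\<lambda>f. if f = 0 then 0 else 1), Ident = id, Comp = (\<lambda>g f. if f < 2 then g else f), Le = (=)\<rparr>"
  define W :: "(nat, nat, nat) weight" where
    "W = \<lparr>wcar = (\<lambda>d. if d = 0 then {0} else {0, 1}), wle = (\<lambda>_. (\<le>)),
      wmap = (\<lambda>f w. if f = 2 then 0 else if f = 3 then 1 else w)\<rparr>"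
  define D where "D = \<lparr>fobj = (\<lambda>d::nat. if d = 0 then A else B),
    farr = (\<lambda>f::nat. if f = 2 then u else if f = 3 then v else Ident C (if f = 0 then A else B))\<rparr>"
  have Js: "Obj J = {0, 1}" "Ident J = id" "Comp J = (\<lambda>g f. if f < 2 then g else f)" "Le J = (=)"
    "Dom J = (\<lambda>f. if f = 1 then 1 else 0)" "Cod J = (\<lambda>f. if f = 0 then 0 else 1)"
    by (simp_all add: J_def)
  note defs = Js W_def D_def
  have HJ: "f \<in> Hom J d d' \<longleftrightarrow> d = 0 \<and> d' = 0 \<and> f = 0 \<or> d = 1 \<and> d' = 1 \<and> f = 1 \<or>
      d = 0 \<and> d' = 1 \<and> f \<in> {2, 3}" for f d d'
    by (auto simp: Hom_def J_def split: if_splits)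
  have fin: "finite (Hom J d d')" for d d'
    by (rule finite_subset[of _ "{0, 1, 2, 3}"]) (auto simp: HJ)
  have J: "pos_category J"
    by unfold_locales (auto simp: HJ poset_on_def reflp_on_def antisymp_on_def transp_on_def,
      auto simp: J_def HJ)
  have W: "finite_weight J W"
    using J fin unfolding finite_weight_def is_weight_def
    by (auto simp: HJ defs poset_on_def reflp_on_def antisymp_on_def transp_on_def monotone_on_def
        split: if_splits)
  have D: "pos_functor J C D"
    unfolding pos_functor_def
  proof (intro conjI ballI)
    note Id = Ident_in_Hom[OF AO] Ident_in_Hom[OF BO]
    note comp = Comp_Ident[OF u] Comp_Ident[OF v] Ident_Comp[OF u] Ident_Comp[OF v]
      Comp_Ident[OF Id(1)] Comp_Ident[OF Id(2)]
    have FD: "fobj D 0 = A" "fobj D 1 = B" "farr D 0 = Ident C A" "farr D 1 = Ident C B"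
      "farr D 2 = u" "farr D 3 = v" by (simp_all add: D_def)
    show "fobj D d \<in> Obj C" for d using AO BO by (simp add: D_def)
    show "farr D f \<in> Hom C (fobj D d) (fobj D d')" if "f \<in> Hom J d d'" for d d' f
      using that[unfolded HJ] Id u v by (elim disjE conjE insertE emptyE) (simp_all only: FD)
    then show "monotone_on (Hom J d d') (Le J) (Le C) (farr D)" for d d'
      by (auto simp: monotone_on_def Js intro: le_refl)
    show "farr D (Ident J d) = Ident C (fobj D d)" if "d \<in> Obj J" for d
      using that by (auto simp: D_def Js)
    show "farr D (g \<cdot>\<^bsub>J\<^esub> f) = farr D g \<cdot> farr D f" if "f \<in> Hom J d d'" "g \<in> Hom J d' d''" for d d' d'' f g
      using that[unfolded HJ] by (elim disjE conjE insertE emptyE) (simp_all add: FD[simplified] Js comp)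
  qed (fact J pos_category_axioms)+
  obtain I where L: "is_weighted_limit C J D W I"
    using lim W D unfolding has_finite_limits_def by blast
  obtain \<kappa> where \<kappa>: "\<kappa> \<in> wcones C J D W I"
    and surj: "\<And>A. A \<in> Obj C \<Longrightarrow> wcone_comp C J W \<kappa> ` Hom C A I = wcones C J D W A"
    and le: "\<And>A h h'. \<lbrakk>h \<in> Hom C A I; h' \<in> Hom C A I;
       wcone_le C J W (wcone_comp C J W \<kappa> h) (wcone_comp C J W \<kappa> h')\<rbrakk> \<Longrightarrow> h \<preceq>\<^bsub>C\<^esub> h'"
    using weighted_limit_cone[OF pos_category_axioms L] by metis
  define w where "w = \<kappa> 0 0"
  have w: "w \<in> Hom C I A"
    using \<kappa> by (auto simp: wcones_def defs w_def PiE_iff)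
  have nat: "\<kappa> d' (wmap W f x) = farr D f \<cdot> \<kappa> d x"
    if "d \<in> Obj J" "d' \<in> Obj J" "f \<in> Hom J d d'" "x \<in> wcar W d" for d d' f x
    using \<kappa> that by (auto simp: wcones_def)
  \<comment> \<open>Naturality along arrows \<open>2\<close> and \<open>3\<close> determines the
    other components by \<open>w\<close>, so comparing two arrows after \<open>w\<close> already
    compares their whole cones. This makes \<open>w\<close> order-monic.\<close>
  have \<kappa>1: "\<kappa> 1 0 = u \<cdot> w" "\<kappa> 1 1 = v \<cdot> w"
    using nat[of 0 1 2 0] nat[of 0 1 3 0] by (simp_all add: HJ w_def) (simp_all add: defs)
  have uvw: "u \<cdot> w \<preceq> v \<cdot> w"
    using \<kappa> unfolding \<kappa>1[symmetric] by (auto simp: wcones_def defs monotone_on_def)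
  have ex: "\<exists>h\<in>Hom C X I. w \<cdot> h = x" if x: "x \<in> Hom C X A" and le: "u \<cdot> x \<preceq> v \<cdot> x" for X x
  proof -
    define \<phi> where "\<phi> = (\<lambda>d\<in>Obj J. \<lambda>w\<in>wcar W d. if d = 0 then x else if w = 0 then u \<cdot> x else v \<cdot> x)"
    note xH = Comp_in_Hom[OF x u] Comp_in_Hom[OF x v]
    have "\<phi> \<in> wcones C J D W X"
      using x xH Ident_Comp[OF x] Ident_Comp[OF xH(1)] Ident_Comp[OF xH(2)]
        le_refl[OF x] le_refl[OF xH(1)] le_refl[OF xH(2)] le
      unfolding wcones_def \<phi>_def
      by (auto simp: HJ defs monotone_on_def)
    then obtain h where h: "h \<in> Hom C X I" "\<phi> = wcone_comp C J W \<kappa> h"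
      using surj Hom_Obj[OF x] by blast
    have "w \<cdot> h = x"
      using fun_cong[OF fun_cong[OF h(2), of 0], of 0]
      by (simp add: \<phi>_def wcone_comp_def w_def defs)
    then show ?thesis using h by blast
  qed
  have "order_mono C w"
    unfolding order_mono_def
  proof (intro conjI ballI impI)
    show "w \<in> Arr C" using HomD[OF w] by blast
    fix X h h' assume "X \<in> Obj C" "h \<in> Hom C X (Dom C w)" "h' \<in> Hom C X (Dom C w)"
      and hh: "w \<cdot> h \<preceq> w \<cdot> h'"
    then have h: "h \<in> Hom C X I" "h' \<in> Hom C X I" using HomD[OF w] by auto
    have "(u \<cdot> w) \<cdot> h \<preceq> (u \<cdot> w) \<cdot> h'" "(v \<cdot> w) \<cdot> h \<preceq> (v \<cdot> w) \<cdot> h'"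
      using Comp_mono_right[OF Comp_in_Hom[OF h(1) w] Comp_in_Hom[OF h(2) w] _ hh] u v
        Comp_assoc[OF h(1) w] Comp_assoc[OF h(2) w]
      by auto
    then show "h \<preceq> h'"
      using hh \<kappa>1 by (intro le[OF h]) (auto simp: wcone_le_def wcone_comp_def defs w_def)
  qed
  then show thesis using that w uvw ex by blast
qed

section \<open>Products, so-morphisms, weak commas and weak pullbacks\<close>

lemma product_lift:
  assumes "is_product C X Y Q p q" "x \<in> Hom C A X" "y \<in> Hom C A Y"
  shows "\<exists>h\<in>Hom C A Q. p \<cdot> h = x \<and> q \<cdot> h = y"
proof -
  have "(\<lambda>h. (p \<cdot> h, q \<cdot> h)) ` Hom C A Q = Hom C A X \<times> Hom C A Y"
    using assms(1) Hom_Obj[OF assms(2)] by (auto simp: is_product_def poset_iso_def bij_betw_def)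
  then have "(x, y) \<in> (\<lambda>h. (p \<cdot> h, q \<cdot> h)) ` Hom C A Q" using assms(2,3) by simp
  then show ?thesis by auto
qed

lemma product_le:
  assumes "is_product C X Y Q p q" "h \<in> Hom C A Q" "h' \<in> Hom C A Q"
    "p \<cdot> h \<preceq> p \<cdot> h'" "q \<cdot> h \<preceq> q \<cdot> h'"
  shows "h \<preceq> h'"
  using assms Hom_Obj[OF assms(2)] by (auto simp: is_product_def poset_iso_def)

lemma product_eq:
  assumes "is_product C X Y Q p q" "h \<in> Hom C A Q" "h' \<in> Hom C A Q"
    "p \<cdot> h = p \<cdot> h'" "q \<cdot> h = q \<cdot> h'"
  shows "h = h'"
proof -
  have "p \<in> Hom C Q X" "q \<in> Hom C Q Y" using assms(1) by (auto simp: is_product_def)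
  then show ?thesis
    using product_le[OF assms(1-3)] product_le[OF assms(1,3,2)] assms(4,5) le_antisym[OF assms(2,3)]
      le_refl Comp_in_Hom[OF assms(3)] by metis
qed

lemma order_mono_le:
  assumes "order_mono C m" "m \<in> Hom C X Y" "u \<in> Hom C A X" "v \<in> Hom C A X" "m \<cdot> u \<preceq> m \<cdot> v"
  shows "u \<preceq> v"
  using assms Hom_Obj[OF assms(3)] HomD[OF assms(2)] by (auto simp: order_mono_def)

text \<open>Surjectivity of the comparison map in \<open>so_morphism\<close> is the existence of
  diagonal fillers.\<close>

lemma so_morphism_fill:
  assumes e: "so_morphism C e" "e \<in> Hom C A B" and m: "order_mono C m" "m \<in> Hom C X Y"
    and u: "u \<in> Hom C A X" and v: "v \<in> Hom C B Y" and sq: "m \<cdot> u = v \<cdot> e"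
  shows "\<exists>d\<in>Hom C B X. d \<cdot> e = u \<and> m \<cdot> d = v"
proof -
  have "(\<lambda>d. (d \<cdot> e, m \<cdot> d)) ` Hom C B X = {(u, v) \<in> Hom C A X \<times> Hom C B Y. m \<cdot> u = v \<cdot> e}"
    using e m HomD[OF e(2)] HomD[OF m(2)] by (auto simp: so_morphism_def poset_iso_def bij_betw_def)
  moreover have "(u, v) \<in> {(u, v) \<in> Hom C A X \<times> Hom C B Y. m \<cdot> u = v \<cdot> e}" using u v sq by simp
  ultimately have "(u, v) \<in> (\<lambda>d. (d \<cdot> e, m \<cdot> d)) ` Hom C B X" by (simp only:)
  then show ?thesis by auto
qed

text \<open>The inequality says that \<open>e\<close> factors through the inserter \<open>w\<close>
  of \<open>u\<close> and \<open>v\<close>. As \<open>w\<close> is order-monic, a diagonal filler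
  splits it, and composing \<open>u \<cdot> w \<preceq> v \<cdot> w\<close> with the splitting gives
  the claim.\<close>

lemma so_morphism_order_epi:
  assumes lim: "has_finite_limits C" and e: "so_morphism C e" "e \<in> Hom C A B"
    and u: "u \<in> Hom C B Z" and v: "v \<in> Hom C B Z" and le: "u \<cdot> e \<preceq> v \<cdot> e"
  shows "u \<preceq> v"
proof -
  obtain I w where w: "w \<in> Hom C I B" "order_mono C w" "u \<cdot> w \<preceq> v \<cdot> w"
    and univ: "\<And>X x. \<lbrakk>x \<in> Hom C X B; u \<cdot> x \<preceq> v \<cdot> x\<rbrakk> \<Longrightarrow> \<exists>y\<in>Hom C X I. w \<cdot> y = x"
    using exists_inserter[OF lim u v] by metis
  obtain y where y: "y \<in> Hom C A I" "w \<cdot> y = e" using univ[OF e(2) le] by blast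
  have I: "Ident C B \<in> Hom C B B" using Ident_in_Hom Hom_Obj[OF u] by blast
  obtain d where d: "d \<in> Hom C B I" "w \<cdot> d = Ident C B"
    using so_morphism_fill[OF e w(2,1) y(1) I] y(2) Ident_Comp[OF e(2)] by auto
  have "(u \<cdot> w) \<cdot> d \<preceq> (v \<cdot> w) \<cdot> d"
    using Comp_mono_left[OF d(1) _ _ w(3)] Comp_in_Hom[OF w(1)] u v by blast
  then show ?thesis
    using Comp_assoc[OF d(1) w(1) u] Comp_assoc[OF d(1) w(1) v] Comp_Ident u v d(2) by simp
qed

text \<open>The inserter of \<open>f \<cdot> p\<close> and \<open>g \<cdot> q\<close> on the product
  \<open>X \<times> Y\<close>.\<close>

lemma exists_weak_comma:
  assumes lim: "has_finite_limits C" and f: "f \<in> Hom C X Z" and g: "g \<in> Hom C Y Z"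
  obtains K k0 k1 where "k0 \<in> Hom C K X" "k1 \<in> Hom C K Y" "f \<cdot> k0 \<preceq> g \<cdot> k1"
    "\<And>A a b. \<lbrakk>a \<in> Hom C A X; b \<in> Hom C A Y; f \<cdot> a \<preceq> g \<cdot> b\<rbrakk> \<Longrightarrow>
       \<exists>u\<in>Hom C A K. k0 \<cdot> u = a \<and> k1 \<cdot> u = b"
proof -
  have "X \<in> Obj C" "Y \<in> Obj C" using Hom_Obj f g by auto
  then obtain Q p q where Q: "is_product C X Y Q p q" using exists_product[OF lim] by blast
  have p: "p \<in> Hom C Q X" and q: "q \<in> Hom C Q Y" using Q by (auto simp: is_product_def)
  obtain I w where w: "w \<in> Hom C I Q" "(f \<cdot> p) \<cdot> w \<preceq> (g \<cdot> q) \<cdot> w"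
    and univ: "\<And>X x. \<lbrakk>x \<in> Hom C X Q; (f \<cdot> p) \<cdot> x \<preceq> (g \<cdot> q) \<cdot> x\<rbrakk> \<Longrightarrow> \<exists>y\<in>Hom C X I. w \<cdot> y = x"
    using exists_inserter[OF lim Comp_in_Hom[OF p f] Comp_in_Hom[OF q g]] by metis
  show thesis
  proof
    show "p \<cdot> w \<in> Hom C I X" "q \<cdot> w \<in> Hom C I Y" using Comp_in_Hom w(1) p q by auto
    show "f \<cdot> (p \<cdot> w) \<preceq> g \<cdot> (q \<cdot> w)"
      using w(2) Comp_assoc[OF w(1) p f] Comp_assoc[OF w(1) q g] by simp
    fix A a b assume a: "a \<in> Hom C A X" and b: "b \<in> Hom C A Y" and le: "f \<cdot> a \<preceq> g \<cdot> b"
    obtain x where x: "x \<in> Hom C A Q" "p \<cdot> x = a" "q \<cdot> x = b" using product_lift[OF Q a b] by blast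
    obtain y where y: "y \<in> Hom C A I" "w \<cdot> y = x"
      using univ[OF x(1)] le x(2,3) Comp_assoc[OF x(1) p f] Comp_assoc[OF x(1) q g] by auto
    show "\<exists>u\<in>Hom C A I. (p \<cdot> w) \<cdot> u = a \<and> (q \<cdot> w) \<cdot> u = b"
      using y x(2,3) Comp_assoc[OF y(1) w(1) p] Comp_assoc[OF y(1) w(1) q] by auto
  qed
qed

text \<open>An equality is a pair of opposite inequalities: on the weak comma object, insert the
  reverse inequality and conclude by antisymmetry.\<close>

lemma exists_weak_pullback:
  assumes lim: "has_finite_limits C" and f: "f \<in> Hom C X Z" and g: "g \<in> Hom C Y Z"
  obtains K k0 k1 where "k0 \<in> Hom C K X" "k1 \<in> Hom C K Y" "f \<cdot> k0 = g \<cdot> k1"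
    "\<And>A a b. \<lbrakk>a \<in> Hom C A X; b \<in> Hom C A Y; f \<cdot> a = g \<cdot> b\<rbrakk> \<Longrightarrow>
       \<exists>u\<in>Hom C A K. k0 \<cdot> u = a \<and> k1 \<cdot> u = b"
proof -
  obtain K k0 k1 where k: "k0 \<in> Hom C K X" "k1 \<in> Hom C K Y" "f \<cdot> k0 \<preceq> g \<cdot> k1"
    and kuniv: "\<And>A a b. \<lbrakk>a \<in> Hom C A X; b \<in> Hom C A Y; f \<cdot> a \<preceq> g \<cdot> b\<rbrakk> \<Longrightarrow>
       \<exists>u\<in>Hom C A K. k0 \<cdot> u = a \<and> k1 \<cdot> u = b"
    using exists_weak_comma[OF lim f g] by metis
  obtain I w where w: "w \<in> Hom C I K" "(g \<cdot> k1) \<cdot> w \<preceq> (f \<cdot> k0) \<cdot> w"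
    and univ: "\<And>X x. \<lbrakk>x \<in> Hom C X K; (g \<cdot> k1) \<cdot> x \<preceq> (f \<cdot> k0) \<cdot> x\<rbrakk> \<Longrightarrow> \<exists>y\<in>Hom C X I. w \<cdot> y = x"
    using exists_inserter[OF lim Comp_in_Hom[OF k(2) g] Comp_in_Hom[OF k(1) f]] by metis
  note H = Comp_in_Hom[OF w(1) Comp_in_Hom[OF k(1) f]] Comp_in_Hom[OF w(1) Comp_in_Hom[OF k(2) g]]
  show thesis
  proof
    show "k0 \<cdot> w \<in> Hom C I X" "k1 \<cdot> w \<in> Hom C I Y" using Comp_in_Hom w(1) k by auto
    have "(f \<cdot> k0) \<cdot> w \<preceq> (g \<cdot> k1) \<cdot> w"
      using Comp_mono_left[OF w(1) _ _ k(3)] Comp_in_Hom k f g by blast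
    then show "f \<cdot> (k0 \<cdot> w) = g \<cdot> (k1 \<cdot> w)"
      using le_antisym[OF H] w(2) Comp_assoc[OF w(1) k(1) f] Comp_assoc[OF w(1) k(2) g] by simp
    fix A a b assume a: "a \<in> Hom C A X" and b: "b \<in> Hom C A Y" and eq: "f \<cdot> a = g \<cdot> b"
    note r = le_refl[OF Comp_in_Hom[OF b g]]
    obtain x where x: "x \<in> Hom C A K" "k0 \<cdot> x = a" "k1 \<cdot> x = b"
      using kuniv[OF a b] r eq by auto
    obtain y where y: "y \<in> Hom C A I" "w \<cdot> y = x"
      using univ[OF x(1)] r eq x(2,3) Comp_assoc[OF x(1) k(1) f] Comp_assoc[OF x(1) k(2) g] by auto
    show "\<exists>u\<in>Hom C A I. (k0 \<cdot> w) \<cdot> u = a \<and> (k1 \<cdot> w) \<cdot> u = b"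
      using y x(2,3) Comp_assoc[OF y(1) w(1) k(1)] Comp_assoc[OF y(1) w(1) k(2)] by auto
  qed
qed

end


section \<open>Exact categories with a projective cover\<close>

locale covered_exact_category = pos_category E
  for E :: "('o, 'm) pos_cat" (structure) +
  fixes \<P> :: "'o set"
  assumes exact: "exact_category E" and cover: "projective_cover E \<P>"
begin

abbreviation "\<C> \<equiv> full_subcategory E \<P>"

lemma lim: "has_finite_limits E"
  using exact by (simp add: exact_category_def regular_category_def)

lemma \<P>_Obj: "\<P> \<subseteq> Obj E"
  using cover by (auto simp: projective_cover_def projective_def)

lemma factorization:
  assumes "f \<in> Hom E X Y"
  obtains I e m where "so_morphism E e" "e \<in> Hom E X I" "order_mono E m" "m \<in> Hom E I Y" "m \<cdot> e = f"
proof -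
  obtain e m where "so_morphism E e" "order_mono E m"
    "Dom E e = X" "Cod E e = Dom E m" "Cod E m = Y" "f = m \<cdot> e"
    using exact HomD[OF assms] unfolding exact_category_def regular_category_def by metis
  moreover from this have "e \<in> Hom E X (Dom E m)" "m \<in> Hom E (Dom E m) Y"
    by (auto simp: Hom_def so_morphism_def order_mono_def)
  ultimately show thesis using that by blast
qed

lemma cover_obtain:
  assumes "X \<in> Obj E"
  obtains Q e where "Q \<in> \<P>" "e \<in> Hom E Q X" "so_morphism E e"
  using cover assms unfolding projective_cover_def by blast

lemma projective_lift:
  assumes "Q \<in> \<P>" "so_morphism E e" "e \<in> Hom E A B" "h \<in> Hom E Q B"
  shows "\<exists>k\<in>Hom E Q A. e \<cdot> k = h"
proof -
  have "(\<lambda>h. e \<cdot> h) ` Hom E Q A = Hom E Q B"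
    using cover assms(1,2) HomD[OF assms(3)] by (auto simp: projective_cover_def projective_def)
  then have "h \<in> (\<lambda>h. e \<cdot> h) ` Hom E Q A" using assms(4) by (simp only:)
  then show ?thesis by auto
qed

text \<open>Factoring the pairing of \<open>q\<close> and \<open>g\<close> through its image
  \<open>I\<close>, the first projection \<open>I \<rightarrow> B\<close> is order-monic, so \<open>q\<close> admits a diagonal filler against it.\<close>

lemma so_morphism_quotient:
  assumes q: "so_morphism E q" "q \<in> Hom E X B" and g: "g \<in> Hom E X Z"
    and ker: "\<And>A a b. \<lbrakk>A \<in> \<P>; a \<in> Hom E A X; b \<in> Hom E A X; q \<cdot> a \<preceq> q \<cdot> b\<rbrakk> \<Longrightarrow> g \<cdot> a \<preceq> g \<cdot> b"
  shows "\<exists>h\<in>Hom E B Z. h \<cdot> q = g"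
proof -
  have "B \<in> Obj E" "Z \<in> Obj E" using Hom_Obj q(2) g by auto
  then obtain T s t where T: "is_product E B Z T s t" using exists_product[OF lim] by blast
  have s: "s \<in> Hom E T B" and t: "t \<in> Hom E T Z" using T by (auto simp: is_product_def)
  obtain k where k: "k \<in> Hom E X T" "s \<cdot> k = q" "t \<cdot> k = g" using product_lift[OF T q(2) g] by blast
  obtain I e m where e: "so_morphism E e" "e \<in> Hom E X I" and m: "order_mono E m" "m \<in> Hom E I T"
    and me: "m \<cdot> e = k" using factorization[OF k(1)] .
  define i j where "i = s \<cdot> m" and "j = t \<cdot> m"
  have i: "i \<in> Hom E I B" and j: "j \<in> Hom E I Z" using Comp_in_Hom m(2) s t by (auto simp: i_def j_def)
  have ie: "i \<cdot> e = q" and je: "j \<cdot> e = g"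
    using Comp_assoc[OF e(2) m(2) s] Comp_assoc[OF e(2) m(2) t] me k by (auto simp: i_def j_def)
  have "order_mono E i"
    unfolding order_mono_def
  proof (intro conjI ballI impI)
    show "i \<in> Arr E" using HomD[OF i] by blast
    fix A u v assume A: "A \<in> Obj E" and "u \<in> Hom E A (Dom E i)" "v \<in> Hom E A (Dom E i)"
      and le: "i \<cdot> u \<preceq> i \<cdot> v"
    then have u: "u \<in> Hom E A I" and v: "v \<in> Hom E A I" using HomD[OF i] by auto
    \<comment> \<open>The hypothesis \<open>ker\<close> tests only objects of \<open>\<P>\<close>,
      so \<open>A\<close> is covered by one; there \<open>u \<cdot> p\<close> and
      \<open>v \<cdot> p\<close> lift along \<open>e\<close> to generalized elements of
      \<open>X\<close>, where \<open>ker\<close> applies.\<close>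
    obtain Q p where Q: "Q \<in> \<P>" and p: "p \<in> Hom E Q A" "so_morphism E p" using cover_obtain[OF A] .
    note up = Comp_in_Hom[OF p(1) u] and vp = Comp_in_Hom[OF p(1) v]
    obtain a b where a: "a \<in> Hom E Q X" "e \<cdot> a = u \<cdot> p" and b: "b \<in> Hom E Q X" "e \<cdot> b = v \<cdot> p"
      using projective_lift[OF Q e up] projective_lift[OF Q e vp] by blast
    have iup: "i \<cdot> (u \<cdot> p) \<preceq> i \<cdot> (v \<cdot> p)"
      using Comp_mono_left[OF p(1) Comp_in_Hom[OF u i] Comp_in_Hom[OF v i] le]
        Comp_assoc[OF p(1) u i] Comp_assoc[OF p(1) v i] by simp
    then have "q \<cdot> a \<preceq> q \<cdot> b"
      using Comp_assoc[OF a(1) e(2) i] Comp_assoc[OF b(1) e(2) i] ie a b by simp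
    then have "g \<cdot> a \<preceq> g \<cdot> b" using ker[OF Q a(1) b(1)] by blast
    then have jup: "j \<cdot> (u \<cdot> p) \<preceq> j \<cdot> (v \<cdot> p)"
      using Comp_assoc[OF a(1) e(2) j] Comp_assoc[OF b(1) e(2) j] je a b by simp
    \<comment> \<open>Both components of the inequality are known. It then descends in two
      cancellations: \<open>m\<close> is order-monic and \<open>p\<close> is order-epi.\<close>
    have "m \<cdot> (u \<cdot> p) \<preceq> m \<cdot> (v \<cdot> p)"
      by (rule product_le[OF T Comp_in_Hom[OF up m(2)] Comp_in_Hom[OF vp m(2)]])
        (use iup jup Comp_assoc[OF up m(2) s] Comp_assoc[OF vp m(2) s]
          Comp_assoc[OF up m(2) t] Comp_assoc[OF vp m(2) t] in \<open>simp_all add: i_def j_def\<close>)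
    then have "u \<cdot> p \<preceq> v \<cdot> p" by (rule order_mono_le[OF m up vp])
    then show "u \<preceq> v" by (rule so_morphism_order_epi[OF lim p(2,1) u v])
  qed
  moreover have I: "Ident E B \<in> Hom E B B" using Ident_in_Hom[OF \<open>B \<in> Obj E\<close>] .
  \<comment> \<open>The filler of the square \<open>i \<cdot> e = Ident E B \<cdot> q\<close>. The
    required map is \<open>j \<cdot> d\<close>, the second projection of the image after this
    section of the first.\<close>
  ultimately obtain d where d: "d \<in> Hom E B I" "d \<cdot> q = e"
    using so_morphism_fill[OF q _ i e(2) I] ie Ident_Comp[OF q(2)] by auto
  have "(j \<cdot> d) \<cdot> q = g" using Comp_assoc[OF q(2) d(1) j] d(2) je by simp
  then show ?thesis using Comp_in_Hom[OF d(1) j] by blast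
qed


section \<open>Pseudocongruences in \<open>\<C>\<close> expressed by arrows of
  \<open>E\<close>\<close>

sublocale P: pos_category \<C>
  by (rule pos_category_full_subcategory[OF pos_category_axioms \<P>_Obj])

lemma Hom_\<C>: "A \<in> \<P> \<Longrightarrow> B \<in> \<P> \<Longrightarrow> Hom \<C> A B = Hom E A B"
  by (simp add: Hom_full_subcategory)

lemma pseudocongruence_\<C>D:
  assumes "pseudocongruence \<C> (r0, r1)"
  shows "Dom E r0 \<in> \<P>" "Cod E r0 \<in> \<P>"
    "r0 \<in> Hom E (Dom E r0) (Cod E r0)" "r1 \<in> Hom E (Dom E r0) (Cod E r0)"
  using P.Hom_Obj[OF pseudocongruenceD(1)[OF assms]] pseudocongruenceD[OF assms]
  by (auto simp: Hom_\<C>)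

lemma ex_pre_\<C>:
  assumes "A \<in> \<P>" "Dom E s0 \<in> \<P>" "f \<in> Hom E A X"
  shows "ex_pre \<C> (s0, s1) f g \<longleftrightarrow> (\<exists>\<sigma>\<in>Hom E A (Dom E s0). s0 \<cdot> \<sigma> = f \<and> s1 \<cdot> \<sigma> = g)"
  using assms HomD[OF assms(3)] by (auto simp: ex_pre_def Hom_\<C>)

text \<open>A lift of \<open>f\<close> to the relations is exactly a witness that
  \<open>f \<cdot> r0\<close> precedes \<open>f \<cdot> r1\<close>. Compatibility of
  \<open>f\<close> thus becomes an instance of the preorder, to which the kernel condition in
  \<open>presents\<close> applies.\<close>

lemma ex_maps_\<C>:
  assumes r: "pseudocongruence \<C> (r0, r1)" and s: "pseudocongruence \<C> (s0, s1)"
  shows "f \<in> ex_maps \<C> (r0, r1) (s0, s1) \<longleftrightarrow>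
    f \<in> Hom E (Cod E r0) (Cod E s0) \<and> ex_pre \<C> (s0, s1) (f \<cdot> r0) (f \<cdot> r1)"
  using pseudocongruence_\<C>D[OF r] pseudocongruence_\<C>D[OF s] HomD[OF Comp_in_Hom[of r0]]
  by (auto simp: ex_maps_def ex_pre_def Hom_\<C>)

text \<open>Cover a weak pullback taken in \<open>E\<close> by an object of \<open>\<P>\<close>. The
  universal property survives because the test objects are projective.\<close>

lemma exists_weak_pullback_cover:
  assumes f: "f \<in> Hom \<C> X Z" and g: "g \<in> Hom \<C> Y Z"
  shows "\<exists>d0 d1. is_weak_pullback \<C> f g d0 d1"
proof -
  have o: "X \<in> \<P>" "Y \<in> \<P>" "Z \<in> \<P>" using P.Hom_Obj f g by auto
  note f' = f[unfolded Hom_\<C>[OF o(1,3)]] and g' = g[unfolded Hom_\<C>[OF o(2,3)]]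
  obtain K k0 k1 where k: "k0 \<in> Hom E K X" "k1 \<in> Hom E K Y" "f \<cdot> k0 = g \<cdot> k1"
    and univ: "\<And>A a b. \<lbrakk>a \<in> Hom E A X; b \<in> Hom E A Y; f \<cdot> a = g \<cdot> b\<rbrakk> \<Longrightarrow>
       \<exists>u\<in>Hom E A K. k0 \<cdot> u = a \<and> k1 \<cdot> u = b"
    using exists_weak_pullback[OF lim f' g'] by metis
  obtain S p where S: "S \<in> \<P>" and p: "p \<in> Hom E S K" "so_morphism E p"
    using cover_obtain Hom_Obj[OF k(1)] by blast
  define d0 d1 where "d0 = k0 \<cdot> p" and "d1 = k1 \<cdot> p"
  have d: "d0 \<in> Hom E S X" "d1 \<in> Hom E S Y" using Comp_in_Hom p(1) k by (auto simp: d0_def d1_def)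
  have eq: "f \<cdot> d0 = g \<cdot> d1"
    using Comp_assoc[OF p(1) k(1) f'] Comp_assoc[OF p(1) k(2) g'] k(3) by (simp add: d0_def d1_def)
  have im: "(\<lambda>h. (d0 \<cdot> h, d1 \<cdot> h)) ` Hom E A S =
      {(u, v) \<in> Hom E A X \<times> Hom E A Y. f \<cdot> u = g \<cdot> v}" if A: "A \<in> \<P>" for A
  proof (intro equalityI subsetI)
    fix z assume "z \<in> (\<lambda>h. (d0 \<cdot> h, d1 \<cdot> h)) ` Hom E A S"
    then obtain h where h: "h \<in> Hom E A S" "z = (d0 \<cdot> h, d1 \<cdot> h)" by blast
    then show "z \<in> {(u, v) \<in> Hom E A X \<times> Hom E A Y. f \<cdot> u = g \<cdot> v}"
      using Comp_in_Hom[OF h(1) d(1)] Comp_in_Hom[OF h(1) d(2)]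
        Comp_assoc[OF h(1) d(1) f'] Comp_assoc[OF h(1) d(2) g'] eq by simp
  next
    fix z assume "z \<in> {(u, v) \<in> Hom E A X \<times> Hom E A Y. f \<cdot> u = g \<cdot> v}"
    then obtain a b where z: "z = (a, b)" "a \<in> Hom E A X" "b \<in> Hom E A Y" "f \<cdot> a = g \<cdot> b" by blast
    obtain u where u: "u \<in> Hom E A K" "k0 \<cdot> u = a" "k1 \<cdot> u = b" using univ z by blast
    obtain h where h: "h \<in> Hom E A S" "p \<cdot> h = u" using projective_lift[OF A p(2,1) u(1)] by blast
    have "d0 \<cdot> h = a" "d1 \<cdot> h = b"
      using Comp_assoc[OF h(1) p(1) k(1)] Comp_assoc[OF h(1) p(1) k(2)] h(2) u by (simp_all add: d0_def d1_def)
    then show "z \<in> (\<lambda>h. (d0 \<cdot> h, d1 \<cdot> h)) ` Hom E A S" using z(1) h(1) by auto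
  qed
  have D: "Dom E d0 = S" "Dom E f = X" "Dom E g = Y" using HomD d f g by fastforce+
  have "cospan \<C> f g" "span_over \<C> f g d0 d1"
    using HomD[OF f] HomD[OF g] d[folded Hom_\<C>[OF S o(1)] Hom_\<C>[OF S o(2)]]
    by (auto simp: cospan_def span_over_def Hom_def)
  then have "is_weak_pullback \<C> f g d0 d1"
    using eq im S o by (simp add: is_weak_pullback_def D Hom_\<C>)
  then show ?thesis by blast
qed


subsection \<open>Presentations\<close>

text \<open>In \<open>E\<close>, a presented pseudocongruence \<open>r\<close> on \<open>X\<close> has \<open>q\<close> as its quotient: the image of \<open>r\<close> in
  \<open>X \<times> X\<close> is the kernel congruence of \<open>q\<close>.\<close>

definition presents :: "'m \<times> 'm \<Rightarrow> 'm \<Rightarrow> bool" where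
  "presents r q \<longleftrightarrow> pseudocongruence \<C> r \<and> so_morphism E q \<and> Dom E q = Cod E (fst r) \<and>
     (\<forall>A\<in>\<P>. \<forall>a\<in>Hom E A (Dom E q). \<forall>b\<in>Hom E A (Dom E q). q \<cdot> a \<preceq> q \<cdot> b \<longleftrightarrow> ex_pre \<C> r a b)"

lemma presentsD:
  assumes "presents (r0, r1) q"
  shows "pseudocongruence \<C> (r0, r1)" "so_morphism E q" "q \<in> Hom E (Cod E r0) (Cod E q)"
    "\<And>A a b. \<lbrakk>A \<in> \<P>; a \<in> Hom E A (Cod E r0); b \<in> Hom E A (Cod E r0)\<rbrakk> \<Longrightarrow>
       q \<cdot> a \<preceq> q \<cdot> b \<longleftrightarrow> ex_pre \<C> (r0, r1) a b"
  using assms by (auto simp: presents_def Hom_def so_morphism_def)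

text \<open>The pair \<open>(r0, r1)\<close> factors through itself by the identity.\<close>

lemma presents_comp:
  assumes "presents (r0, r1) q"
  shows "q \<cdot> r0 \<preceq> q \<cdot> r1"
proof -
  note p = presentsD[OF assms] and r = pseudocongruence_\<C>D[OF presentsD(1)[OF assms]]
  have "Ident E (Dom E r0) \<in> Hom E (Dom E r0) (Dom E r0)" using Ident_in_Hom r(1) \<P>_Obj by blast
  then have "ex_pre \<C> (r0, r1) r0 r1"
    unfolding ex_pre_\<C>[OF r(1,1,3)] using Comp_Ident[OF r(3)] Comp_Ident[OF r(4)] by blast
  then show ?thesis using p(4)[OF r(1,3,4)] by blast
qed

text \<open>A pair \<open>(a, b)\<close> from an object of \<open>\<P>\<close> satisfies
  \<open>q \<cdot> a \<preceq> q \<cdot> b\<close> iff it lifts to the weak kernel \<open>K\<close>,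
  iff it lifts to the cover \<open>R\<close> of \<open>K\<close>. Both clauses of
  \<open>pseudocongruence\<close> follow from this equivalence: the first by monotonicity of
  composition with \<open>q\<close>, the second by transitivity in the hom-posets into
  \<open>B\<close>.\<close>

lemma exists_presentation_of_object:
  assumes B: "B \<in> Obj E"
  shows "\<exists>r q. presents r q \<and> Cod E q = B"
proof -
  obtain X q where X: "X \<in> \<P>" and q: "q \<in> Hom E X B" "so_morphism E q" using cover_obtain[OF B] .
  obtain K k0 k1 where k: "k0 \<in> Hom E K X" "k1 \<in> Hom E K X" "q \<cdot> k0 \<preceq> q \<cdot> k1"
    and univ: "\<And>A a b. \<lbrakk>a \<in> Hom E A X; b \<in> Hom E A X; q \<cdot> a \<preceq> q \<cdot> b\<rbrakk> \<Longrightarrow>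
       \<exists>u\<in>Hom E A K. k0 \<cdot> u = a \<and> k1 \<cdot> u = b"
    using exists_weak_comma[OF lim q(1) q(1)] by metis
  obtain R p where R: "R \<in> \<P>" and p: "p \<in> Hom E R K" "so_morphism E p"
    using cover_obtain Hom_Obj[OF k(1)] by blast
  define r0 r1 where "r0 = k0 \<cdot> p" and "r1 = k1 \<cdot> p"
  have r: "r0 \<in> Hom E R X" "r1 \<in> Hom E R X" using Comp_in_Hom p(1) k by (auto simp: r0_def r1_def)
  have D: "Dom E r0 = R" "Cod E r0 = X" "Dom E r1 = R" "Cod E r1 = X" using HomD r by fastforce+
  have "(q \<cdot> k0) \<cdot> p \<preceq> (q \<cdot> k1) \<cdot> p"
    using Comp_mono_left[OF p(1) _ _ k(3)] Comp_in_Hom k(1,2) q(1) by blast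
  then have qr: "q \<cdot> r0 \<preceq> q \<cdot> r1"
    using Comp_assoc[OF p(1) k(1) q(1)] Comp_assoc[OF p(1) k(2) q(1)] by (simp add: r0_def r1_def)
  have qrs: "q \<cdot> (r0 \<cdot> \<sigma>) \<preceq> q \<cdot> (r1 \<cdot> \<sigma>)" if \<sigma>: "\<sigma> \<in> Hom E A R" for A \<sigma>
    using Comp_mono_left[OF \<sigma> Comp_in_Hom[OF r(1) q(1)] Comp_in_Hom[OF r(2) q(1)] qr]
      Comp_assoc[OF \<sigma> r(1) q(1)] Comp_assoc[OF \<sigma> r(2) q(1)] by simp
  have ker: "q \<cdot> a \<preceq> q \<cdot> b \<longleftrightarrow> (\<exists>\<sigma>\<in>Hom E A R. r0 \<cdot> \<sigma> = a \<and> r1 \<cdot> \<sigma> = b)"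
    if A: "A \<in> \<P>" and a: "a \<in> Hom E A X" and b: "b \<in> Hom E A X" for A a b
  proof
    assume "q \<cdot> a \<preceq> q \<cdot> b"
    then obtain u where u: "u \<in> Hom E A K" "k0 \<cdot> u = a" "k1 \<cdot> u = b" using univ a b by blast
    obtain \<sigma> where \<sigma>: "\<sigma> \<in> Hom E A R" "p \<cdot> \<sigma> = u" using projective_lift[OF A p(2,1) u(1)] by blast
    then show "\<exists>\<sigma>\<in>Hom E A R. r0 \<cdot> \<sigma> = a \<and> r1 \<cdot> \<sigma> = b"
      using Comp_assoc[OF \<sigma>(1) p(1) k(1)] Comp_assoc[OF \<sigma>(1) p(1) k(2)] u by (auto simp: r0_def r1_def)
  qed (use qrs in blast)
  have rC: "r0 \<in> Hom \<C> R X" "r1 \<in> Hom \<C> R X" using r R X by (simp_all add: Hom_\<C>)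
  obtain d0 d1 where wp: "is_weak_pullback \<C> r1 r0 d0 d1"
    using exists_weak_pullback_cover[OF rC(2,1)] by blast
  define S where "S = Dom E d0"
  have "d0 \<in> Hom \<C> S R" "d1 \<in> Hom \<C> S R"
    using wp D by (auto simp: is_weak_pullback_def span_over_def Hom_def S_def)
  then have S: "S \<in> \<P>" and d: "d0 \<in> Hom E S R" "d1 \<in> Hom E S R"
    using P.Hom_Obj by (auto simp: Hom_full_subcategory split: if_splits)
  have "r1 \<cdot> d0 = r0 \<cdot> d1" using wp by (simp add: is_weak_pullback_def)
  \<comment> \<open>The chain is \<open>q r0 d0 \<le> q r1 d0 = q r0 d1 \<le> q r1 d1\<close>. As
    its source \<open>S\<close> lies in \<open>\<P>\<close>, \<open>ker\<close> turns it into
    \<open>\<tau>\<close>.\<close>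
  then have "q \<cdot> (r0 \<cdot> d0) \<preceq> q \<cdot> (r1 \<cdot> d1)"
    using qrs[OF d(1)] qrs[OF d(2)] le_trans[of _ S B] Comp_in_Hom[OF _ q(1)] Comp_in_Hom[OF d(1)]
      Comp_in_Hom[OF d(2)] r by metis
  then have t: "\<exists>\<tau>\<in>Hom E S R. r0 \<cdot> \<tau> = r0 \<cdot> d0 \<and> r1 \<cdot> \<tau> = r1 \<cdot> d1"
    using ker[OF S Comp_in_Hom[OF d(1) r(1)] Comp_in_Hom[OF d(2) r(2)]] by blast
  have "Hom \<C> (Dom E d0) R = Hom E S R" using S R by (simp add: Hom_\<C> S_def[symmetric])
  then have "\<exists>d0 d1. is_weak_pullback \<C> r1 r0 d0 d1 \<and>
      (\<exists>\<tau>\<in>Hom \<C> (Dom E d0) R. r0 \<cdot> \<tau> = r0 \<cdot> d0 \<and> r1 \<cdot> \<tau> = r1 \<cdot> d1)"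
    using wp t by metis
  moreover have "\<exists>u\<in>Hom E A R. r0 \<cdot> u = a0 \<and> r1 \<cdot> u = a1"
    if "A \<in> \<P>" "a0 \<in> Hom E A X" "a1 \<in> Hom E A X" "a0 \<preceq> a1" for A a0 a1
    using ker[OF that(1-3)] Comp_mono_right[OF that(2,3) q(1) that(4)] by blast
  ultimately have "pseudocongruence \<C> (r0, r1)"
    unfolding pseudocongruence_def prod.case
    using HomD[OF rC(1)] HomD[OF rC(2)] R X by (simp add: D Hom_\<C>)
  moreover have "ex_pre \<C> (r0, r1) a b \<longleftrightarrow> q \<cdot> a \<preceq> q \<cdot> b"
    if "A \<in> \<P>" "a \<in> Hom E A X" "b \<in> Hom E A X" for A a b
    using ker[OF that] ex_pre_\<C>[OF that(1) _ that(2)] R by (simp add: D)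
  ultimately have "presents (r0, r1) q"
    using q HomD[OF q(1)] by (simp add: presents_def D)
  then show ?thesis using HomD[OF q(1)] by blast
qed

text \<open>Here exactness is used: the image of a pseudocongruence is a congruence in \<open>E\<close>, hence the kernel
  congruence of some \<open>f\<close>, and the so-part of \<open>f\<close> has the same kernel.\<close>

lemma exists_presentation_of_pseudocongruence:
  assumes "pseudocongruence \<C> r"
  shows "\<exists>q. presents r q"
proof -
  obtain r0 r1 where rr: "r = (r0, r1)" by fastforce
  note pr = assms[unfolded rr]
  define R X where "R = Dom E r0" and "X = Cod E r0"
  note r = pseudocongruence_\<C>D[OF pr, folded R_def X_def]
  have XO: "X \<in> Obj E" using r(2) \<P>_Obj by blast
  obtain T s t where T: "is_product E X X T s t" using exists_product[OF lim XO XO] by blast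
  have s: "s \<in> Hom E T X" and t: "t \<in> Hom E T X" using T by (auto simp: is_product_def)
  obtain k where k: "k \<in> Hom E R T" "s \<cdot> k = r0" "t \<cdot> k = r1" using product_lift[OF T r(3,4)] by blast
  \<comment> \<open>The image of the pairing of \<open>r0\<close> and \<open>r1\<close>; its
    components \<open>e0\<close>, \<open>e1\<close> form the candidate congruence.\<close>
  obtain I e m where e: "so_morphism E e" "e \<in> Hom E R I" and m: "order_mono E m" "m \<in> Hom E I T"
    and me: "m \<cdot> e = k" using factorization[OF k(1)] .
  define e0 e1 where "e0 = s \<cdot> m" and "e1 = t \<cdot> m"
  have e01: "e0 \<in> Hom E I X" "e1 \<in> Hom E I X" using Comp_in_Hom m(2) s t by (auto simp: e0_def e1_def)
  have re: "e0 \<cdot> e = r0" "e1 \<cdot> e = r1"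
    using Comp_assoc[OF e(2) m(2) s] Comp_assoc[OF e(2) m(2) t] me k by (auto simp: e0_def e1_def)
  have ft: "factors_through E e0 e1 x y \<longleftrightarrow> (\<exists>u\<in>Hom E A I. e0 \<cdot> u = x \<and> e1 \<cdot> u = y)"
    if "x \<in> Hom E A X" for A x y
    using HomD[OF that] HomD[OF e01(1)] by (simp add: factors_through_def)
  \<comment> \<open>Over objects of \<open>\<P>\<close> the image and \<open>r\<close> relate the
    same pairs, since arrows into the image lift along \<open>e\<close>.\<close>
  have ft_\<P>: "factors_through E e0 e1 x y \<longleftrightarrow> ex_pre \<C> r x y"
    if A: "A \<in> \<P>" and x: "x \<in> Hom E A X" for A x y
    unfolding ft[OF x] rr ex_pre_\<C>[OF A r(1)[unfolded R_def] x] R_def[symmetric]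
  proof
    assume "\<exists>u\<in>Hom E A I. e0 \<cdot> u = x \<and> e1 \<cdot> u = y"
    then obtain u where u: "u \<in> Hom E A I" "e0 \<cdot> u = x" "e1 \<cdot> u = y" by blast
    obtain \<sigma> where \<sigma>: "\<sigma> \<in> Hom E A R" "e \<cdot> \<sigma> = u" using projective_lift[OF A e u(1)] by blast
    then show "\<exists>\<sigma>\<in>Hom E A R. r0 \<cdot> \<sigma> = x \<and> r1 \<cdot> \<sigma> = y"
      using Comp_assoc[OF \<sigma>(1) e(2) e01(1)] Comp_assoc[OF \<sigma>(1) e(2) e01(2)] re u by auto
  next
    assume "\<exists>\<sigma>\<in>Hom E A R. r0 \<cdot> \<sigma> = x \<and> r1 \<cdot> \<sigma> = y"
    then obtain \<sigma> where \<sigma>: "\<sigma> \<in> Hom E A R" "r0 \<cdot> \<sigma> = x" "r1 \<cdot> \<sigma> = y" by blast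
    then show "\<exists>u\<in>Hom E A I. e0 \<cdot> u = x \<and> e1 \<cdot> u = y"
      using Comp_assoc[OF \<sigma>(1) e(2) e01(1)] Comp_assoc[OF \<sigma>(1) e(2) e01(2)] re
        Comp_in_Hom[OF \<sigma>(1) e(2)] by metis
  qed
  \<comment> \<open>Membership in the image is local for so-morphisms. For the converse direction,
    with \<open>z\<close> the pairing of \<open>x\<close> and \<open>y\<close>, the square
    \<open>m \<cdot> u = z \<cdot> p\<close> has a filler, as \<open>m\<close> is
    order-monic.\<close>
  have ft_cover: "factors_through E e0 e1 x y \<longleftrightarrow> factors_through E e0 e1 (x \<cdot> p) (y \<cdot> p)"
    if x: "x \<in> Hom E A X" and y: "y \<in> Hom E A X" and p: "p \<in> Hom E Q A" "so_morphism E p" for A Q x y p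
    unfolding ft[OF x] ft[OF Comp_in_Hom[OF p(1) x]]
  proof
    assume "\<exists>u\<in>Hom E A I. e0 \<cdot> u = x \<and> e1 \<cdot> u = y"
    then show "\<exists>u\<in>Hom E Q I. e0 \<cdot> u = x \<cdot> p \<and> e1 \<cdot> u = y \<cdot> p"
      using Comp_assoc[OF p(1) _ e01(1)] Comp_assoc[OF p(1) _ e01(2)] Comp_in_Hom[OF p(1)] by metis
  next
    assume "\<exists>u\<in>Hom E Q I. e0 \<cdot> u = x \<cdot> p \<and> e1 \<cdot> u = y \<cdot> p"
    then obtain u where u: "u \<in> Hom E Q I" "e0 \<cdot> u = x \<cdot> p" "e1 \<cdot> u = y \<cdot> p" by blast
    obtain z where z: "z \<in> Hom E A T" "s \<cdot> z = x" "t \<cdot> z = y" using product_lift[OF T x y] by blast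
    have "m \<cdot> u = z \<cdot> p"
      by (rule product_eq[OF T Comp_in_Hom[OF u(1) m(2)] Comp_in_Hom[OF p(1) z(1)]])
        (use u z Comp_assoc[OF u(1) m(2) s] Comp_assoc[OF u(1) m(2) t]
          Comp_assoc[OF p(1) z(1) s] Comp_assoc[OF p(1) z(1) t] in \<open>simp_all add: e0_def e1_def\<close>)
    then obtain d where d: "d \<in> Hom E A I" "m \<cdot> d = z"
      using so_morphism_fill[OF p(2,1) m u(1) z(1)] by blast
    then show "\<exists>u\<in>Hom E A I. e0 \<cdot> u = x \<and> e1 \<cdot> u = y"
      using Comp_assoc[OF d(1) m(2) s] Comp_assoc[OF d(1) m(2) t] z by (auto simp: e0_def e1_def)
  qed
  \<comment> \<open>One cover \<open>p\<close> of \<open>A\<close> serves all pairs at once, so the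
    congruence axioms, which involve several pairs, reduce to facts about \<open>ex_pre\<close> on a
    single object of \<open>\<P>\<close>.\<close>
  have pre: "\<exists>Q p. Q \<in> \<P> \<and> p \<in> Hom E Q A \<and> (\<forall>x\<in>Hom E A X. \<forall>y\<in>Hom E A X.
      factors_through E e0 e1 x y \<longleftrightarrow> ex_pre \<C> r (x \<cdot> p) (y \<cdot> p))" if A: "A \<in> Obj E" for A
  proof -
    obtain Q p where "Q \<in> \<P>" "p \<in> Hom E Q A" "so_morphism E p" using cover_obtain[OF A] .
    then show ?thesis using ft_cover ft_\<P> Comp_in_Hom by metis
  qed
  have HC: "x \<cdot> p \<in> Hom \<C> Q (Cod \<C> r0)" if "Q \<in> \<P>" "p \<in> Hom E Q A" "x \<in> Hom E A X" for Q p A x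
    using Comp_in_Hom[OF that(2,3)] that(1) r(2) by (simp add: Hom_\<C> X_def)
  note tr = P.ex_pre_trans[OF pr, folded rr]
  have "congruence_on E X e0 e1"
    unfolding congruence_on_def
  proof (intro conjI ballI impI)
    show "relation_on E X e0 e1"
      unfolding relation_on_def using T m HomD[OF m(2)] e0_def e1_def by blast
  next
    fix A x assume A: "A \<in> Obj E" and x: "x \<in> Hom E A X"
    show "factors_through E e0 e1 x x"
      using pre[OF A] x P.ex_pre_refl[OF pr HC, folded rr] by blast
  next
    fix A x y z assume A: "A \<in> Obj E" and x: "x \<in> Hom E A X" "y \<in> Hom E A X" "z \<in> Hom E A X"
      and "factors_through E e0 e1 x y \<and> factors_through E e0 e1 y z"
    then show "factors_through E e0 e1 x z"
      using pre[OF A] tr[OF _ _ HC HC] by blast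
  next
    fix A x y x' y' assume A: "A \<in> Obj E" and x: "x \<in> Hom E A X" "y \<in> Hom E A X"
        "x' \<in> Hom E A X" "y' \<in> Hom E A X"
      and h: "factors_through E e0 e1 x y \<and> x' \<preceq> x \<and> y \<preceq> y'"
    obtain Q p where Q: "Q \<in> \<P>" "p \<in> Hom E Q A"
      and fp: "\<And>x y. x \<in> Hom E A X \<Longrightarrow> y \<in> Hom E A X \<Longrightarrow>
        factors_through E e0 e1 x y \<longleftrightarrow> ex_pre \<C> r (x \<cdot> p) (y \<cdot> p)" using pre[OF A] by blast
    note H = HC[OF Q]
    \<comment> \<open>The first clause of a pseudocongruence makes \<open>ex_pre\<close> contain the
      order; the ideal property is this together with transitivity.\<close>
    have "ex_pre \<C> r (x' \<cdot> p) (x \<cdot> p)" "ex_pre \<C> r (y \<cdot> p) (y' \<cdot> p)"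
      using P.ex_pre_of_le[OF pr H H, folded rr] Comp_mono_left[OF Q(2)] x h by auto
    moreover have "ex_pre \<C> r (x \<cdot> p) (y \<cdot> p)" using fp x h by blast
    ultimately have "ex_pre \<C> r (x' \<cdot> p) (y' \<cdot> p)" using tr[OF _ _ H H] x by metis
    then show "factors_through E e0 e1 x' y'" using fp x by blast
  qed
  then obtain f where f: "is_comma E f f e0 e1"
    using exact unfolding exact_category_def effective_def by blast
  define Z where "Z = Cod E f"
  have fH: "f \<in> Hom E X Z" and fe: "f \<cdot> e0 \<preceq> f \<cdot> e1"
    using f HomD[OF e01(1)] by (auto simp: is_comma_def cospan_def span_over_def Hom_def Z_def)
  have comma: "f \<cdot> a \<preceq> f \<cdot> b \<longleftrightarrow> factors_through E e0 e1 a b"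
    if a: "a \<in> Hom E A X" and b: "b \<in> Hom E A X" for A a b
    unfolding ft[OF a]
  proof
    assume le: "f \<cdot> a \<preceq> f \<cdot> b"
    have "(\<lambda>h. (e0 \<cdot> h, e1 \<cdot> h)) ` Hom E A I = {(u, v) \<in> Hom E A X \<times> Hom E A X. f \<cdot> u \<preceq> f \<cdot> v}"
      using f Hom_Obj[OF a] HomD[OF fH] HomD[OF e01(1)]
      by (auto simp: is_comma_def poset_iso_def bij_betw_def)
    moreover have "(a, b) \<in> {(u, v) \<in> Hom E A X \<times> Hom E A X. f \<cdot> u \<preceq> f \<cdot> v}" using a b le by simp
    ultimately have "(a, b) \<in> (\<lambda>h. (e0 \<cdot> h, e1 \<cdot> h)) ` Hom E A I" by (simp only:)
    then show "\<exists>u\<in>Hom E A I. e0 \<cdot> u = a \<and> e1 \<cdot> u = b" by auto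
  next
    assume "\<exists>u\<in>Hom E A I. e0 \<cdot> u = a \<and> e1 \<cdot> u = b"
    then obtain u where u: "u \<in> Hom E A I" "e0 \<cdot> u = a" "e1 \<cdot> u = b" by blast
    show "f \<cdot> a \<preceq> f \<cdot> b"
      using Comp_mono_left[OF u(1) Comp_in_Hom[OF e01(1) fH] Comp_in_Hom[OF e01(2) fH] fe]
        Comp_assoc[OF u(1) e01(1) fH] Comp_assoc[OF u(1) e01(2) fH] u by simp
  qed
  obtain B q n where q: "so_morphism E q" "q \<in> Hom E X B" and n: "order_mono E n" "n \<in> Hom E B Z"
    and nq: "n \<cdot> q = f" using factorization[OF fH] .
  \<comment> \<open>Passing from \<open>f\<close> to its so-part keeps the kernel, because
    \<open>n\<close> is order-monic.\<close>
  have qf: "q \<cdot> a \<preceq> q \<cdot> b \<longleftrightarrow> f \<cdot> a \<preceq> f \<cdot> b"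
    if a: "a \<in> Hom E A X" and b: "b \<in> Hom E A X" for A a b
    using order_mono_le[OF n Comp_in_Hom[OF a q(2)] Comp_in_Hom[OF b q(2)]]
      Comp_mono_right[OF Comp_in_Hom[OF a q(2)] Comp_in_Hom[OF b q(2)] n(2)]
      Comp_assoc[OF a q(2) n(2)] Comp_assoc[OF b q(2) n(2)] nq by auto
  have "presents r q"
    using assms q(1) HomD[OF q(2)] qf comma ft_\<P> by (auto simp: presents_def rr X_def)
  then show ?thesis by blast
qed

section \<open>Maps of presented pseudocongruences and maps of their quotients\<close>

lemma presents_descend:
  assumes r: "presents r q" and s: "presents s q'" and f: "f \<in> ex_maps \<C> r s"
  shows "\<exists>h\<in>Hom E (Cod E q) (Cod E q'). h \<cdot> q = q' \<cdot> f"
proof -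
  obtain r0 r1 s0 s1 where e: "r = (r0, r1)" "s = (s0, s1)" by fastforce
  note pr = presentsD[OF r[unfolded e]] and ps = presentsD[OF s[unfolded e]]
  note r' = pseudocongruence_\<C>D[OF pr(1)]
  have fH: "f \<in> Hom E (Cod E r0) (Cod E s0)" and fp: "ex_pre \<C> (s0, s1) (f \<cdot> r0) (f \<cdot> r1)"
    using f unfolding e ex_maps_\<C>[OF pr(1) ps(1)] by auto
  note g = Comp_in_Hom[OF fH ps(3)]
  note fr = Comp_in_Hom[OF r'(3) fH] Comp_in_Hom[OF r'(4) fH]
  have "q' \<cdot> (f \<cdot> r0) \<preceq> q' \<cdot> (f \<cdot> r1)" using ps(4)[OF r'(1) fr] fp by blast
  then have gr: "(q' \<cdot> f) \<cdot> r0 \<preceq> (q' \<cdot> f) \<cdot> r1"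
    using Comp_assoc[OF r'(3) fH ps(3)] Comp_assoc[OF r'(4) fH ps(3)] by simp
  show ?thesis
  \<comment> \<open>Over \<open>\<P>\<close>, pairs in the kernel of \<open>q\<close> have the form
    \<open>(r0 \<cdot> \<sigma>, r1 \<cdot> \<sigma>)\<close>, so the kernel condition for
    \<open>q' \<cdot> f\<close> follows from the single inequality \<open>gr\<close> at the generic
    pair \<open>(r0, r1)\<close>.\<close>
  proof (rule so_morphism_quotient[OF pr(2,3) g])
    fix A a b assume A: "A \<in> \<P>" and a: "a \<in> Hom E A (Cod E r0)" and b: "b \<in> Hom E A (Cod E r0)"
      and "q \<cdot> a \<preceq> q \<cdot> b"
    then obtain \<sigma> where \<sigma>: "\<sigma> \<in> Hom E A (Dom E r0)" "r0 \<cdot> \<sigma> = a" "r1 \<cdot> \<sigma> = b"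
      using pr(4)[OF A a b] ex_pre_\<C>[OF A r'(1) a] by auto
    show "(q' \<cdot> f) \<cdot> a \<preceq> (q' \<cdot> f) \<cdot> b"
      using Comp_mono_left[OF \<sigma>(1) Comp_in_Hom[OF r'(3) g] Comp_in_Hom[OF r'(4) g] gr]
        Comp_assoc[OF \<sigma>(1) r'(3) g] Comp_assoc[OF \<sigma>(1) r'(4) g] \<sigma> by simp
  qed
qed

text \<open>Projectivity of the underlying object of \<open>r\<close> lifts
  \<open>h \<cdot> q\<close> along \<open>q'\<close>. Any such lift \<open>f\<close> is compatible:
  \<open>q' f r0 = h q r0 \<le> h q r1 = q' f r1\<close>, and the kernel of \<open>q'\<close> is
  presented by \<open>s\<close>.\<close>

lemma presents_lift:
  assumes r: "presents r q" and s: "presents s q'" and h: "h \<in> Hom E (Cod E q) (Cod E q')"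
  shows "\<exists>f\<in>ex_maps \<C> r s. h \<cdot> q = q' \<cdot> f"
proof -
  obtain r0 r1 s0 s1 where e: "r = (r0, r1)" "s = (s0, s1)" by fastforce
  note pr = presentsD[OF r[unfolded e]] and ps = presentsD[OF s[unfolded e]]
  note r' = pseudocongruence_\<C>D[OF pr(1)]
  obtain f where f: "f \<in> Hom E (Cod E r0) (Cod E s0)" "q' \<cdot> f = h \<cdot> q"
    using projective_lift[OF r'(2) ps(2,3) Comp_in_Hom[OF pr(3) h]] by blast
  have "h \<cdot> (q \<cdot> r0) \<preceq> h \<cdot> (q \<cdot> r1)"
    using Comp_mono_right[OF _ _ h presents_comp[OF r[unfolded e]]] Comp_in_Hom r'(3,4) pr(3) by blast
  then have "q' \<cdot> (f \<cdot> r0) \<preceq> q' \<cdot> (f \<cdot> r1)"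
    using Comp_assoc[OF r'(3) f(1) ps(3)] Comp_assoc[OF r'(4) f(1) ps(3)]
      Comp_assoc[OF r'(3) pr(3) h] Comp_assoc[OF r'(4) pr(3) h] f(2) by simp
  then have "f \<in> ex_maps \<C> r s"
    unfolding e ex_maps_\<C>[OF pr(1) ps(1)]
    using ps(4)[OF r'(1) Comp_in_Hom[OF r'(3) f(1)] Comp_in_Hom[OF r'(4) f(1)]] f(1) by blast
  then show ?thesis using f(2) by metis
qed

text \<open>Cancel the order-epi \<open>q\<close>, then use the kernel condition of
  \<open>q'\<close> at the underlying object of \<open>r\<close>, which lies in
  \<open>\<P>\<close>.\<close>

lemma presents_le:
  assumes r: "presents r q" and s: "presents s q'"
    and f: "f \<in> ex_maps \<C> r s" "f' \<in> ex_maps \<C> r s"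
    and h: "h \<in> Hom E (Cod E q) (Cod E q')" "h' \<in> Hom E (Cod E q) (Cod E q')"
    and eq: "h \<cdot> q = q' \<cdot> f" "h' \<cdot> q = q' \<cdot> f'"
  shows "h \<preceq> h' \<longleftrightarrow> ex_pre \<C> s f f'"
proof -
  obtain r0 r1 s0 s1 where e: "r = (r0, r1)" "s = (s0, s1)" by fastforce
  note pr = presentsD[OF r[unfolded e]] and ps = presentsD[OF s[unfolded e]]
  have fH: "f \<in> Hom E (Cod E r0) (Cod E s0)" "f' \<in> Hom E (Cod E r0) (Cod E s0)"
    using f unfolding e ex_maps_\<C>[OF pr(1) ps(1)] by auto
  have "h \<preceq> h' \<longleftrightarrow> h \<cdot> q \<preceq> h' \<cdot> q"
    using so_morphism_order_epi[OF lim pr(2,3) h] Comp_mono_left[OF pr(3) h] by blast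
  also have "\<dots> \<longleftrightarrow> ex_pre \<C> s f f'"
    unfolding eq e by (rule ps(4)[OF pseudocongruence_\<C>D(2)[OF pr(1)] fH])
  finally show ?thesis .
qed


subsection \<open>The correspondence of morphisms\<close>

text \<open>Any representative may be used, so no choice among them is made;
  \<open>descent_eq\<close> shows that the description is unique on arrows between presented
  pseudocongruences.\<close>

definition descent :: "('m \<times> 'm) \<times> 'm \<Rightarrow> ('m \<times> 'm) \<times> 'm \<Rightarrow>
    ('m \<times> 'm) \<times> ('m \<times> 'm) \<times> 'm set \<Rightarrow> 'm" where
  "descent t t' \<phi> = (THE h. h \<in> Hom E (Cod E (snd t)) (Cod E (snd t')) \<and>
     (\<exists>f\<in>snd (snd \<phi>). h \<cdot> snd t = snd t' \<cdot> f))"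

lemma descent_eq:
  assumes r: "presents r q" and s: "presents s q'" and f: "f \<in> ex_maps \<C> r s"
    and h: "h \<in> Hom E (Cod E q) (Cod E q')" "h \<cdot> q = q' \<cdot> f"
  shows "descent (r, q) (s, q') (r, s, ex_equiv \<C> r s `` {f}) = h"
  unfolding descent_def snd_conv
proof (rule the_equality)
  have p: "pseudocongruence \<C> r" "pseudocongruence \<C> s" using r s by (auto simp: presents_def)
  show "h \<in> Hom E (Cod E q) (Cod E q') \<and> (\<exists>f\<in>ex_equiv \<C> r s `` {f}. h \<cdot> q = q' \<cdot> f)"
    using h equiv_class_self[OF P.ex_equiv_equiv[OF p] f] by blast
  fix h' assume "h' \<in> Hom E (Cod E q) (Cod E q') \<and> (\<exists>f\<in>ex_equiv \<C> r s `` {f}. h' \<cdot> q = q' \<cdot> f)"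
  then obtain f' where h': "h' \<in> Hom E (Cod E q) (Cod E q')" "h' \<cdot> q = q' \<cdot> f'"
    and f': "f' \<in> ex_maps \<C> r s" "ex_pre \<C> s f f'" "ex_pre \<C> s f' f"
    by (auto simp: ex_equiv_def)
  \<comment> \<open>Equivalent representatives precede each other, so \<open>presents_le\<close>
    gives both inequalities between the induced maps.\<close>
  show "h' = h"
    using presents_le[OF r s f f'(1) h(1) h'(1) h(2) h'(2)]
      presents_le[OF r s f'(1) f h'(1) h(1) h'(2) h(2)] f'(2,3) le_antisym[OF h(1) h'(1)] by simp
qed

lemma descent_class:
  assumes "presents r q" "presents s q'" "\<phi> \<in> Hom (ex_completion \<C>) r s"
  shows "\<exists>f\<in>ex_maps \<C> r s. \<phi> = (r, s, ex_equiv \<C> r s `` {f}) \<and>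
    descent (r, q) (s, q') \<phi> \<in> Hom E (Cod E q) (Cod E q') \<and>
    descent (r, q) (s, q') \<phi> \<cdot> q = q' \<cdot> f"
proof -
  obtain f where f: "f \<in> ex_maps \<C> r s" "\<phi> = (r, s, ex_equiv \<C> r s `` {f})"
    using P.ex_arr_class(3)[OF assms(3)] by blast
  obtain h where h: "h \<in> Hom E (Cod E q) (Cod E q')" "h \<cdot> q = q' \<cdot> f"
    using presents_descend[OF assms(1,2) f(1)] by blast
  show ?thesis using f h descent_eq[OF assms(1,2) f(1) h] by auto
qed

lemma descent_Comp:
  assumes p: "presents r q" "presents s q'" "presents t q''"
    and \<phi>: "\<phi> \<in> Hom (ex_completion \<C>) r s" and \<psi>: "\<psi> \<in> Hom (ex_completion \<C>) s t"
  shows "descent (r, q) (t, q'') (\<psi> \<cdot>\<^bsub>ex_completion \<C>\<^esub> \<phi>) =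
    descent (s, q') (t, q'') \<psi> \<cdot> descent (r, q) (s, q') \<phi>"
proof -
  obtain r0 r1 s0 s1 t0 t1 where e: "r = (r0, r1)" "s = (s0, s1)" "t = (t0, t1)" by fastforce
  define h k where "h = descent (r, q) (s, q') \<phi>" and "k = descent (s, q') (t, q'') \<psi>"
  obtain f where f: "f \<in> ex_maps \<C> r s" "\<phi> = (r, s, ex_equiv \<C> r s `` {f})"
    and h: "h \<in> Hom E (Cod E q) (Cod E q')" "h \<cdot> q = q' \<cdot> f"
    using descent_class[OF p(1,2) \<phi>] unfolding h_def by blast
  obtain g where g: "g \<in> ex_maps \<C> s t" "\<psi> = (s, t, ex_equiv \<C> s t `` {g})"
    and k: "k \<in> Hom E (Cod E q') (Cod E q'')" "k \<cdot> q' = q'' \<cdot> g"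
    using descent_class[OF p(2,3) \<psi>] unfolding k_def by blast
  note pr = presentsD[OF p(1)[unfolded e]] and ps = presentsD[OF p(2)[unfolded e]]
    and pt = presentsD[OF p(3)[unfolded e]]
  have pp: "pseudocongruence \<C> r" "pseudocongruence \<C> s" "pseudocongruence \<C> t"
    using pr(1) ps(1) pt(1) by (simp_all add: e)
  have H: "f \<in> Hom E (Cod E r0) (Cod E s0)" "g \<in> Hom E (Cod E s0) (Cod E t0)"
    using f(1) g(1) ex_maps_\<C>[OF pr(1) ps(1)] ex_maps_\<C>[OF ps(1) pt(1)] by (auto simp: e)
  have gf: "g \<cdot> f \<in> ex_maps \<C> r t"
    using P.ex_maps_Comp[OF pr(1) ps(1) pt(1)] f(1) g(1) by (simp add: e)
  \<comment> \<open>Pasting the two commutative squares; \<open>descent_eq\<close> then identifies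
    the composite.\<close>
  have "(k \<cdot> h) \<cdot> q = q'' \<cdot> (g \<cdot> f)"
    using Comp_assoc[OF pr(3) h(1) k(1)] Comp_assoc[OF H(1) ps(3) k(1)] Comp_assoc[OF H pt(3)]
      h(2) k(2) by simp
  then have "descent (r, q) (t, q'') (r, t, ex_equiv \<C> r t `` {g \<cdot> f}) = k \<cdot> h"
    by (rule descent_eq[OF p(1,3) gf Comp_in_Hom[OF h(1) k(1)]])
  then show ?thesis
    using P.ex_Comp_class[OF pp f(1) g(1)] by (simp add: f(2) g(2) h_def k_def)
qed

lemma descent_Ident:
  assumes p: "presents r q"
  shows "descent (r, q) (r, q) (Ident (ex_completion \<C>) r) = Ident E (Cod E q)"
proof -
  obtain r0 r1 where e: "r = (r0, r1)" by fastforce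
  note pr = presentsD[OF p[unfolded e]]
  have "Ident E (Cod E r0) \<in> ex_maps \<C> r r" using P.ex_maps_Ident[OF pr(1)] by (simp add: e)
  moreover have "Ident E (Cod E q) \<in> Hom E (Cod E q) (Cod E q)"
    using Ident_in_Hom Hom_Obj[OF pr(3)] by blast
  moreover have "Ident E (Cod E q) \<cdot> q = q \<cdot> Ident E (Cod E r0)"
    using Comp_Ident[OF pr(3)] Ident_Comp[OF pr(3)] by simp
  ultimately have "descent (r, q) (r, q) (r, r, ex_equiv \<C> r r `` {Ident E (Cod E r0)}) = Ident E (Cod E q)"
    by (rule descent_eq[OF p p])
  then show ?thesis by (simp add: ex_completion_def e)
qed

text \<open>Order preservation and reflection come from \<open>presents_le\<close>. Reflection and
  antisymmetry in the completion give injectivity; surjectivity is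
  \<open>presents_lift\<close>.\<close>

lemma descent_iso:
  assumes p: "presents r q" "presents s q'"
  shows "poset_iso (Hom (ex_completion \<C>) r s) (Le (ex_completion \<C>))
    (Hom E (Cod E q) (Cod E q')) (Le E) (descent (r, q) (s, q'))"
proof -
  let ?X = "ex_completion \<C>" and ?d = "descent (r, q) (s, q')"
  interpret X: pos_category ?X by (rule P.ex_completion_pos_category)
  have pp: "pseudocongruence \<C> r" "pseudocongruence \<C> s" using p by (auto simp: presents_def)
  have le: "\<phi> \<preceq>\<^bsub>?X\<^esub> \<psi> \<longleftrightarrow> ?d \<phi> \<preceq> ?d \<psi>" if "\<phi> \<in> Hom ?X r s" "\<psi> \<in> Hom ?X r s" for \<phi> \<psi>
    using descent_class[OF p that(1)] descent_class[OF p that(2)] P.ex_Le_class[OF pp]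
      presents_le[OF p] by metis
  have H: "?d \<phi> \<in> Hom E (Cod E q) (Cod E q')" if "\<phi> \<in> Hom ?X r s" for \<phi>
    using descent_class[OF p that] by blast
  have "inj_on ?d (Hom ?X r s)"
  proof (rule inj_onI)
    fix \<phi> \<psi> assume h: "\<phi> \<in> Hom ?X r s" "\<psi> \<in> Hom ?X r s" "?d \<phi> = ?d \<psi>"
    then show "\<phi> = \<psi>"
      using X.le_antisym[OF h(1,2)] le[OF h(1,2)] le[OF h(2,1)] le_refl[OF H[OF h(2)]] by simp
  qed
  moreover have "?d ` Hom ?X r s = Hom E (Cod E q) (Cod E q')"
  proof (intro equalityI subsetI)
    show "h \<in> Hom E (Cod E q) (Cod E q')" if "h \<in> ?d ` Hom ?X r s" for h using that H by blast
    fix h assume h: "h \<in> Hom E (Cod E q) (Cod E q')"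
    obtain f where f: "f \<in> ex_maps \<C> r s" "h \<cdot> q = q' \<cdot> f" using presents_lift[OF p h] by blast
    show "h \<in> ?d ` Hom ?X r s"
      using descent_eq[OF p f(1) h f(2)] P.ex_class_arr[OF pp f(1)] by blast
  qed
  ultimately show ?thesis unfolding poset_iso_def bij_betw_def using le by blast
qed

text \<open>The apex consists of all pairs \<open>(r, q)\<close> with \<open>presents r q\<close>.
  One leg keeps the pseudocongruence, the other the presented object, and the two existence results
  make these legs surjective.\<close>

lemma ex_completion_equivalent: "equivalent_categories (ex_completion \<C>) E"
proof (rule equivalent_categories_of_span[where T = "{(r, q). presents r q}" and a = fst
      and b = "\<lambda>t. Cod E (snd t)" and K = descent])
  show "pos_category (ex_completion \<C>)" by (rule P.ex_completion_pos_category)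
  show "pos_category E" by (rule pos_category_axioms)
  show "fst ` {(r, q). presents r q} = Obj (ex_completion \<C>)"
  proof (intro equalityI subsetI)
    show "r \<in> Obj (ex_completion \<C>)" if "r \<in> fst ` {(r, q). presents r q}" for r
      using that by (auto simp: ex_completion_def presents_def)
    fix r assume "r \<in> Obj (ex_completion \<C>)"
    then have "pseudocongruence \<C> r" by (simp add: ex_completion_def)
    then obtain q where "presents r q" using exists_presentation_of_pseudocongruence by blast
    then show "r \<in> fst ` {(r, q). presents r q}"
      by (intro image_eqI[where x = "(r, q)"]) simp_all
  qed
  show "(\<lambda>t. Cod E (snd t)) ` {(r, q). presents r q} = Obj E"
  proof (intro equalityI subsetI)
    show "B \<in> Obj E" if "B \<in> (\<lambda>t. Cod E (snd t)) ` {(r, q). presents r q}" for B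
      using that Cod_in_Obj by (auto simp: presents_def so_morphism_def)
    fix B assume "B \<in> Obj E"
    then obtain r q where "presents r q" "Cod E q = B" using exists_presentation_of_object by blast
    then show "B \<in> (\<lambda>t. Cod E (snd t)) ` {(r, q). presents r q}"
      by (intro image_eqI[where x = "(r, q)"]) simp_all
  qed
next
  show "poset_iso (Hom (ex_completion \<C>) (fst t) (fst t')) (Le (ex_completion \<C>))
      (Hom E (Cod E (snd t)) (Cod E (snd t'))) (Le E) (descent t t')"
    if "t \<in> {(r, q). presents r q}" "t' \<in> {(r, q). presents r q}" for t t'
    using that descent_iso[of "fst t" "snd t" "fst t'" "snd t'"] by (simp add: case_prod_beta)
  show "descent t t (Ident (ex_completion \<C>) (fst t)) = Ident E (Cod E (snd t))"
    if "t \<in> {(r, q). presents r q}" for t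
    using that descent_Ident[of "fst t" "snd t"] by (simp add: case_prod_beta)
  show "descent r t (\<psi> \<cdot>\<^bsub>ex_completion \<C>\<^esub> \<phi>) = descent s t \<psi> \<cdot> descent r s \<phi>"
    if "r \<in> {(r, q). presents r q}" "s \<in> {(r, q). presents r q}" "t \<in> {(r, q). presents r q}"
      "\<phi> \<in> Hom (ex_completion \<C>) (fst r) (fst s)" "\<psi> \<in> Hom (ex_completion \<C>) (fst s) (fst t)"
    for r s t \<phi> \<psi>
    using that descent_Comp[of "fst r" "snd r" "fst s" "snd s" "fst t" "snd t"]
    by (simp add: case_prod_beta)
qed

end

theorem theorem4p8:
  fixes \<E> :: "('o, 'm) pos_cat" and \<P> :: "'o set"
  assumes "exact_category \<E>"
    and "projective_cover \<E> \<P>"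
  shows "equivalent_categories (ex_completion (full_subcategory \<E> \<P>)) \<E>"
proof -
  interpret covered_exact_category \<E> \<P>
    using assms by (simp add: covered_exact_category_def covered_exact_category_axioms_def
        exact_category_def regular_category_def)
  show ?thesis by (rule ex_completion_equivalent)
qed

end
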